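(* Let $A$ be the path matrix of a (nonnegative weighted) planar network $D$ of order $n$. Then $$\mathrm{per}(A)=\sum_{\pi\in\mathcal P_e(D)}\mathrm{wgt}(\pi)\cdot\#\{P(\pi)\text{-excedance-free permutations of }\pi\}.$$
   Context: A (nonnegative weighted) planar network of order $n$ is a directed, planar, acyclic digraph $D=(V,E)$ which can be embedded in a disc so that $2n$ distinguished vertices, labeled clockwise as $s_1,\dots,s_n,t_n,\dots,t_1$, lie on the boundary of the disc, with a nonnegative real weight assigned to each edge; the sources $s_i$ have indegree $0$ and the sinks $t_i$ have outdegree $0$. The weight of a source-to-sink path is the product of the weights of its edges. The path matrix $A=(a_{i,j})_{i,j\in[n]}$ of $D$ has $a_{i,j}$ equal to the sum of weights of all paths from $s_i$ to $t_j$. A path family $\pi=(\pi_1,\dots,\pi_n)$ has type $w=w_1\cdots w_n\in\mathfrak S_n$ if $\pi_i$ is a path from $s_i$ to $t_{w_i}$ for all $i$; $\mathrm{wgt}(\pi)=\mathrm{wgt}(\pi_1)\cdots\mathrm{wgt}(\pi_n)$. $\mathcal P_e(D)$ is the set of path families in $D$ whose type is the identity. For $\pi\in\mathcal P_e(D)$, $P(\pi)$ is the poset on $\{\pi_1,\dots,\pi_n\}$ with $\pi_i<\pi_j$ if and only if $i<j$ and $\pi_i$, $\pi_j$ do not intersect (share no vertex). A permutation of $\pi$ is a listing $\pi_{v_1}\pi_{v_2}\cdots\pi_{v_n}$ with $v\in\mathfrak S_n$; it is $P(\pi)$-excedance-free if there is no $i$ with $\pi_{v_i}>_{P(\pi)}\pi_i$.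 $\mathrm{per}(A)=\sum_{w\in\mathfrak S_n}a_{1,w_1}\cdots a_{n,w_n}$ is the permanent. *)

theory Defs
  imports
    "HOL-Analysis.Analysis"
    "HOL-Combinatorics.Permutations"
    "Graph_Theory.Arc_Walk"
begin

text \<open>
  The clockwise labelling \<open>s 1, \<dots>, s n, t n, \<dots>, t 1\<close> of the distinguished vertices,
  read at positions \<open>1, \<dots>, 2 * n\<close>.
\<close>

definition boundary_vertex :: "nat \<Rightarrow> (nat \<Rightarrow> 'a) \<Rightarrow> (nat \<Rightarrow> 'a) \<Rightarrow> nat \<Rightarrow> 'a" where
  "boundary_vertex n s t k = (if k \<le> n then s k else t (2 * n + 1 - k))"

text \<open>
  A topological embedding of \<open>D\<close> in the closed unit disc: \<open>\<phi>\<close> places the vertices and \<open>\<gamma> e\<close> draws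
  the edge \<open>e\<close> as an arc, meeting vertices and other edges only at common endpoints.
  Clockwise order on the circle means strictly decreasing angles within less than one full turn;
  in particular the \<open>2 * n\<close> distinguished vertices are distinct.
\<close>

definition disc_embedding ::
  "('a, 'b) pre_digraph \<Rightarrow> nat \<Rightarrow> (nat \<Rightarrow> 'a) \<Rightarrow> (nat \<Rightarrow> 'a) \<Rightarrow>
    ('a \<Rightarrow> complex) \<Rightarrow> ('b \<Rightarrow> real \<Rightarrow> complex) \<Rightarrow> bool" where
  "disc_embedding D n s t \<phi> \<gamma> \<longleftrightarrow>
     inj_on \<phi> (verts D) \<and> \<phi> ` verts D \<subseteq> cball 0 1 \<and>
     (\<forall>e\<in>arcs D. arc (\<gamma> e) \<and> path_image (\<gamma> e) \<subseteq> cball 0 1 \<and>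
        pathstart (\<gamma> e) = \<phi> (tail D e) \<and> pathfinish (\<gamma> e) = \<phi> (head D e)) \<and>
     (\<forall>e\<in>arcs D. \<forall>v\<in>verts D. \<phi> v \<in> path_image (\<gamma> e) \<longrightarrow> v \<in> {tail D e, head D e}) \<and>
     (\<forall>e\<in>arcs D. \<forall>f\<in>arcs D. e \<noteq> f \<longrightarrow>
        path_image (\<gamma> e) \<inter> path_image (\<gamma> f)
          \<subseteq> \<phi> ` ({tail D e, head D e} \<inter> {tail D f, head D f})) \<and>
     (\<exists>\<theta> :: nat \<Rightarrow> real.
        (\<forall>k\<in>{1..2*n}. \<phi> (boundary_vertex n s t k) = cis (\<theta> k)) \<and>
        (\<forall>k\<in>{1..2*n}. \<forall>l\<in>{1..2*n}. k < l \<longrightarrow> \<theta> l < \<theta> k \<and> \<theta> k < \<theta> l + 2 * pi))"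

text \<open>Parallel edges are allowed; a simple digraph is the special case \<^locale>\<open>digraph\<close>.\<close>

locale planar_network = fin_digraph D
  for D :: "('a, 'b) pre_digraph" +
  fixes n :: nat
    and s t :: "nat \<Rightarrow> 'a"
    and wt :: "'b \<Rightarrow> real"
  assumes acyclic_edges: "acyclic (arcs_ends D)"
    and sources_in_verts: "\<And>i. i \<in> {1..n} \<Longrightarrow> s i \<in> verts D"
    and sinks_in_verts: "\<And>i. i \<in> {1..n} \<Longrightarrow> t i \<in> verts D"
    and sources_in_degree: "\<And>i. i \<in> {1..n} \<Longrightarrow> in_degree D (s i) = 0"
    and sinks_out_degree: "\<And>i. i \<in> {1..n} \<Longrightarrow> out_degree D (t i) = 0"
    and weights_nonneg: "\<And>e. e \<in> arcs D \<Longrightarrow> 0 \<le> wt e"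
    and embeddable: "\<exists>\<phi> \<gamma>. disc_embedding D n s t \<phi> \<gamma>"

definition path_weight :: "('b \<Rightarrow> real) \<Rightarrow> 'b awalk \<Rightarrow> real" where
  "path_weight wt p = prod_list (map wt p)"

text \<open>Matrices of order \<open>n\<close> are functions of which only the entries with indices in \<open>{1..n}\<close> matter.\<close>

definition path_matrix ::
  "('a, 'b) pre_digraph \<Rightarrow> (nat \<Rightarrow> 'a) \<Rightarrow> (nat \<Rightarrow> 'a) \<Rightarrow> ('b \<Rightarrow> real) \<Rightarrow> nat \<Rightarrow> nat \<Rightarrow> real" where
  "path_matrix D s t wt i j =
     (\<Sum>p \<in> {p. pre_digraph.apath D (s i) p (t j)}. path_weight wt p)"

definition permanent :: "nat \<Rightarrow> (nat \<Rightarrow> nat \<Rightarrow> 'a::comm_semiring_1) \<Rightarrow> 'a" where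
  "permanent n A = (\<Sum>w \<in> {w. w permutes {1..n}}. \<Prod>i\<in>{1..n}. A i (w i))"

text \<open>Families are extensional functions on \<open>{1..n}\<close>, so that each is counted exactly once.\<close>

definition path_families ::
  "('a, 'b) pre_digraph \<Rightarrow> nat \<Rightarrow> (nat \<Rightarrow> 'a) \<Rightarrow> (nat \<Rightarrow> 'a) \<Rightarrow> (nat \<Rightarrow> nat) \<Rightarrow>
    (nat \<Rightarrow> 'b awalk) set" where
  "path_families D n s t w =
     (\<Pi>\<^sub>E i\<in>{1..n}. {p. pre_digraph.apath D (s i) p (t (w i))})"

definition family_weight :: "nat \<Rightarrow> ('b \<Rightarrow> real) \<Rightarrow> (nat \<Rightarrow> 'b awalk) \<Rightarrow> real" where
  "family_weight n wt \<pi> = (\<Prod>i\<in>{1..n}. path_weight wt (\<pi> i))"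

text \<open>The strict order of the poset \<open>P(\<pi>)\<close>, as a set of pairs (smaller, larger).\<close>

definition family_less ::
  "('a, 'b) pre_digraph \<Rightarrow> nat \<Rightarrow> (nat \<Rightarrow> 'a) \<Rightarrow> (nat \<Rightarrow> 'b awalk) \<Rightarrow> 'b awalk rel" where
  "family_less D n s \<pi> =
     {(\<pi> i, \<pi> j) | i j. i \<in> {1..n} \<and> j \<in> {1..n} \<and> i < j \<and>
        set (pre_digraph.awalk_verts D (s i) (\<pi> i)) \<inter>
        set (pre_digraph.awalk_verts D (s j) (\<pi> j)) = {}}"

text \<open>
  The listing \<open>\<pi> (v 1), \<dots>, \<pi> (v n)\<close> is encoded by the permutation \<open>v\<close>; the paths of a family have
  distinct sources, hence distinct \<open>v\<close> give distinct listings.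
\<close>

definition excedance_free ::
  "('a, 'b) pre_digraph \<Rightarrow> nat \<Rightarrow> (nat \<Rightarrow> 'a) \<Rightarrow> (nat \<Rightarrow> 'b awalk) \<Rightarrow> (nat \<Rightarrow> nat) \<Rightarrow> bool" where
  "excedance_free D n s \<pi> v \<longleftrightarrow>
     \<not> (\<exists>i\<in>{1..n}. (\<pi> i, \<pi> (v i)) \<in> family_less D n s \<pi>)"

end

theory Submission
  imports Defs
begin

text \<open>
  Muir's identity \<open>per A\<^sub>U = \<Sum> (-1)\<^bsup>|B|-1\<^esup> det A\<^sub>B per A\<^sub>U\<^sub>-\<^sub>B\<close>, summed over nonempty
  \<open>B \<subseteq> U\<close>, is applied to two matrices. For the path matrix, planarity and the
  Lindstroem--Gessel--Viennot involution turn \<open>det A\<^sub>B\<close> into the weight of the nonintersecting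
  families on \<open>B\<close>. For a fixed family \<open>\<pi>\<close>, the excedance-free permutations are counted by the
  permanent of the matrix with entry 0 at \<open>(i, j)\<close> if \<open>\<pi>\<^sub>i < \<pi>\<^sub>j\<close> and 1 otherwise, whose minor on
  \<open>B\<close> has determinant 1 or 0 according to whether \<open>B\<close> is a chain, that is, whether \<open>\<pi>\<close> is
  nonintersecting on \<open>B\<close>. So both sides satisfy the same recursion in \<open>U\<close>.

  The topological input is that chords of a disc with interlacing endpoints meet, which the Cayley
  transform reduces to the Fashoda theorem for a rectangle. It gives the transitivity of the order
  on the paths as well.
\<close>

section \<open>Interlacing chords of the disc\<close>

text \<open>The Cayley transform carries the disc minus the point 1 to the upper half plane, after a
  reflection in the real axis.\<close>

definition cayley :: "complex \<Rightarrow> real^2" where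
  "cayley z = (\<chi> i. if i = 1 then Re (\<i> * (z + 1) / (z - 1)) else - Im (\<i> * (z + 1) / (z - 1)))"

lemma cayley_inj: "inj_on cayley (- {1})"
proof (rule inj_onI)
  fix z w :: complex
  assume z: "z \<in> - {1}" and w: "w \<in> - {1}" and eq: "cayley z = cayley w"
  have "cayley z $ 1 = cayley w $ 1" "cayley z $ 2 = cayley w $ 2"
    using eq by simp_all
  then have "\<i> * (z + 1) / (z - 1) = \<i> * (w + 1) / (w - 1)"
    by (intro complex_eqI) (simp_all add: cayley_def)
  then have "(z + 1) * (w - 1) = (w + 1) * (z - 1)"
    using z w by (simp add: field_simps)
  then have "2 * z = 2 * w" by (simp add: algebra_simps)
  then show "z = w" by simp
qed

lemma cayley_continuous: "continuous_on (- {1}) cayley"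
proof -
  have "continuous_on (- {1}) (\<lambda>z. if i = 1 then Re (\<i> * (z + 1) / (z - 1))
    else - Im (\<i> * (z + 1) / (z - 1)))" for i :: 2
    by (cases "i = 1") (auto intro!: continuous_intros)
  then show ?thesis
    unfolding cayley_def by (rule continuous_on_vec_lambda)
qed

text \<open>The numerator of \<open>Re ((z + 1) / (z - 1))\<close> is \<open>|z|^2 - 1\<close>,
  nonpositive on the disc. At the point 1 division by zero yields 0, which satisfies the bound
  too.\<close>

lemma cayley_upper: "norm z \<le> 1 \<Longrightarrow> 0 \<le> cayley z $ 2"
proof -
  assume "norm z \<le> 1"
  then have "(Re z)\<^sup>2 + (Im z)\<^sup>2 \<le> 1"
    by (metis cmod_power2 norm_ge_zero power_le_one)
  moreover have "0 \<le> (Re z - 1)\<^sup>2 + (Im z)\<^sup>2" by simp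
  ultimately have "Re ((z + 1) / (z - 1)) \<le> 0"
    unfolding Re_divide by (intro divide_nonpos_nonneg) (simp_all add: power2_eq_square algebra_simps)
  moreover have "Im (\<i> * (z + 1) / (z - 1)) = Re ((z + 1) / (z - 1))"
    by (metis Im_i_times times_divide_eq_right)
  ultimately show ?thesis by (simp add: cayley_def)
qed

text \<open>Pulling \<open>cis (x / 2)\<close> out of \<open>cis x + 1\<close> and
  \<open>cis x - 1\<close> leaves \<open>2 cos (x / 2)\<close> and
  \<open>2 \<i> sin (x / 2)\<close>. So the circle without 1 goes to the real axis, with the
  cotangent of the half angle as coordinate.\<close>

lemma cayley_cis:
  assumes "0 < x" "x < 2 * pi"
  shows "cayley (cis x) $ 1 = cot (x / 2)" "cayley (cis x) $ 2 = 0"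
proof -
  have s: "sin (x / 2) \<noteq> 0" using assms by (metis divide_pos_pos half_gt_zero_iff mult.commute
        nonzero_mult_div_cancel_left pos_divide_less_eq sin_gt_zero zero_less_numeral less_irrefl)
  have c: "cis x = cis (x / 2) * cis (x / 2)" by (simp add: cis_mult)
  have one: "1 = cis (x / 2) * cis (- (x / 2))" by (simp add: cis_mult)
  have "cis x + 1 = cis (x / 2) * (cis (x / 2) + cis (- (x / 2)))"
    by (simp add: c one distrib_left)
  also have "cis (x / 2) + cis (- (x / 2)) = 2 * of_real (cos (x / 2))"
    by (simp add: complex_eq_iff)
  finally have p: "cis x + 1 = cis (x / 2) * (2 * of_real (cos (x / 2)))" .
  have "cis x - 1 = cis (x / 2) * (cis (x / 2) - cis (- (x / 2)))"
    by (simp add: c one right_diff_distrib)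
  also have "cis (x / 2) - cis (- (x / 2)) = 2 * \<i> * of_real (sin (x / 2))"
    by (simp add: complex_eq_iff)
  finally have m: "cis x - 1 = cis (x / 2) * (2 * \<i> * of_real (sin (x / 2)))" .
  have "\<i> * (cis x + 1) / (cis x - 1) = of_real (cot (x / 2))"
    unfolding p m using s by (simp add: cot_def field_simps)
  then show "cayley (cis x) $ 1 = cot (x / 2)" "cayley (cis x) $ 2 = 0"
    by (simp_all add: cayley_def)
qed

lemma cot_strict_antimono:
  fixes x y :: real
  assumes "0 < x" "x < y" "y < pi"
  shows "cot y < cot x"
proof -
  have "0 < sin (y - x)" "0 < sin x" "0 < sin y"
    using assms by (auto intro!: sin_gt_zero)
  then have "0 < sin (y - x) / (sin x * sin y)" by simp
  also have "\<dots> = cot x - cot y"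
    using \<open>0 < sin x\<close> \<open>0 < sin y\<close> by (simp add: cot_def sin_diff field_simps)
  finally show ?thesis by simp
qed

text \<open>The cotangent decreases, so the images of the angles \<open>a\<close>, \<open>b\<close>,
  \<open>c\<close>, \<open>d\<close> appear on the real axis from left to right. The images of the
  chords are thus interlacing curves in a half plane, and injectivity of \<open>cayley\<close>
  brings their common point back to the disc.\<close>

lemma chords_cross_avoiding_1:
  assumes f: "path f" "path_image f \<subseteq> cball 0 1 - {1}"
      "pathstart f = cis a" "pathfinish f = cis c"
    and g: "path g" "path_image g \<subseteq> cball 0 1 - {1}"
      "pathstart g = cis b" "pathfinish g = cis d"
    and ord: "0 < d" "d < c" "c < b" "b < a" "a < 2 * pi"
  shows "path_image f \<inter> path_image g \<noteq> {}"
proof -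
  let ?F = "cayley \<circ> f" and ?G = "cayley \<circ> g"
  let ?K = "path_image ?F \<union> path_image ?G"
  have pF: "path ?F" and pG: "path ?G"
    using f g by (auto intro!: path_continuous_image continuous_on_subset[OF cayley_continuous])
  have "bounded ?K" using pF pG by (simp add: bounded_path_image)
  then obtain R where R: "\<And>x. x \<in> ?K \<Longrightarrow> norm x \<le> R" by (auto simp: bounded_iff)
  \<comment> \<open>The bottom side of this box lies on the real axis and carries the four
    endpoints.\<close>
  define l u :: "real^2" where "l = vector [- R, 0]" and "u = vector [R, R]"
  have up: "0 \<le> x $ 2" if "x \<in> ?K" for x
    using that f(2) g(2) by (auto simp: path_image_compose intro!: cayley_upper)
  have "x \<in> cbox l u" if "x \<in> ?K" for x
  proof -
    have "\<bar>x $ 1\<bar> \<le> R" "\<bar>x $ 2\<bar> \<le> R"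
      using R[OF that] component_le_norm_cart order_trans by blast+
    with up[OF that] show ?thesis
      by (auto simp: mem_box_cart forall_2 l_def u_def abs_le_iff)
  qed
  then have box: "path_image ?F \<subseteq> cbox l u" "path_image ?G \<subseteq> cbox l u" by auto
  have ends: "pathstart ?F = cayley (cis a)" "pathfinish ?F = cayley (cis c)"
    "pathstart ?G = cayley (cis b)" "pathfinish ?G = cayley (cis d)"
    using f g by (simp_all add: pathstart_compose pathfinish_compose)
  obtain z where "z \<in> path_image ?F" "z \<in> path_image ?G"
  proof (rule fashoda_interlace[OF pF pG box])
    show "pathstart ?F $ 2 = l $ 2" "pathfinish ?F $ 2 = l $ 2"
      "pathstart ?G $ 2 = l $ 2" "pathfinish ?G $ 2 = l $ 2"
      using ord unfolding ends l_def by (subst cayley_cis; simp)+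
    show "pathstart ?F $ 1 < pathstart ?G $ 1" "pathstart ?G $ 1 < pathfinish ?F $ 1"
      "pathfinish ?F $ 1 < pathfinish ?G $ 1"
      unfolding ends using ord by (simp_all add: cayley_cis cot_strict_antimono)
  qed
  then obtain p q where "p \<in> path_image f" "q \<in> path_image g" "cayley p = cayley q"
    by (auto simp: path_image_compose)
  moreover have "p = q"
    using calculation f(2) g(2) by (intro inj_onD[OF cayley_inj]) auto
  ultimately show ?thesis by auto
qed

text \<open>Halving a chord and reattaching it radially to its endpoints makes the endpoints its only points
  on the circle, so a point of the circle away from them can be sent to infinity.\<close>

definition retract_chord :: "(real \<Rightarrow> complex) \<Rightarrow> real \<Rightarrow> complex" where
  "retract_chord f =
     linepath (pathstart f) (pathstart f / 2) +++ (\<lambda>x. f x / 2) +++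
     linepath (pathfinish f / 2) (pathfinish f)"

lemma pathstart_retract_chord [simp]: "pathstart (retract_chord f) = pathstart f"
  and pathfinish_retract_chord [simp]: "pathfinish (retract_chord f) = pathfinish f"
  by (simp_all add: retract_chord_def)

lemma path_retract_chord: "path f \<Longrightarrow> path (retract_chord f)"
proof -
  assume "path f"
  then have "path (\<lambda>x. f x / 2)" by (auto simp: path_def intro!: continuous_intros)
  moreover have "pathstart (\<lambda>x. f x / 2) = pathstart f / 2" "pathfinish (\<lambda>x. f x / 2) = pathfinish f / 2"
    by (simp_all add: pathstart_def pathfinish_def)
  ultimately show ?thesis by (simp add: retract_chord_def)
qed

text \<open>For a chord of the disc, the first alternative has radius at most 1/2 and the second a
  larger one. The strict bound on \<open>r\<close> keeps the two kinds of points apart by their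
  norms.\<close>

lemma path_image_retract_chord:
  assumes "z \<in> path_image (retract_chord f)"
  shows "(\<exists>w\<in>path_image f. z = w / 2) \<or>
    (\<exists>r w. 1/2 < r \<and> r \<le> 1 \<and> z = of_real r * w \<and> w \<in> {pathstart f, pathfinish f})"
proof -
  have seg: "(\<exists>w\<in>path_image f. z = w / 2) \<or> (\<exists>r. 1/2 < r \<and> r \<le> 1 \<and> z = of_real r * w)"
    if zw: "z \<in> closed_segment w (w / 2)" and w: "w \<in> path_image f" for w
  proof -
    obtain u where u: "0 \<le> u" "u \<le> 1" "z = (1 - u) *\<^sub>R w + u *\<^sub>R (w / 2)"
      using zw by (auto simp only: in_segment)
    then have z: "z = of_real (1 - u / 2) * w" by (simp add: scaleR_conv_of_real left_diff_distrib)
    show ?thesis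
    \<comment> \<open>The inner end of the radial segment is a point of the halved chord and is
      counted there.\<close>
    proof (cases "u = 1")
      case True
      then have "z = w / 2" using u(3) by (simp add: scaleR_conv_of_real)
      then show ?thesis using w by blast
    next
      case False
      then have "1/2 < 1 - u / 2" "1 - u / 2 \<le> 1" using u by auto
      then show ?thesis using z by blast
    qed
  qed
  have mid: "path_image (\<lambda>x. f x / 2) = (\<lambda>w. w / 2) ` path_image f"
    by (auto simp: path_image_def)
  have "z \<in> closed_segment (pathstart f) (pathstart f / 2) \<or> z \<in> path_image (\<lambda>x. f x / 2) \<or>
     z \<in> closed_segment (pathfinish f) (pathfinish f / 2)"
    using assms path_image_join_subset[of "linepath (pathstart f) (pathstart f / 2)"]
      path_image_join_subset[of "\<lambda>x. f x / 2"]
    unfolding retract_chord_def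
    by (metis (no_types, lifting) UnE path_image_linepath closed_segment_commute subsetD)
  then show ?thesis
  proof (elim disjE)
    assume "z \<in> closed_segment (pathstart f) (pathstart f / 2)"
    from seg[OF this pathstart_in_path_image] show ?thesis by blast
  next
    assume "z \<in> closed_segment (pathfinish f) (pathfinish f / 2)"
    from seg[OF this pathfinish_in_path_image] show ?thesis by blast
  qed (use mid in blast)
qed

lemma cis_eq_1_imp_0:
  assumes "cis x = 1" "\<bar>x\<bar> < 2 * pi"
  shows "x = 0"
proof -
  have "cos x = 1" using assms(1) by (simp add: complex_eq_iff)
  then obtain n :: int where n: "x = n * (2 * pi)" by (auto simp: cos_one_2pi_int)
  have "\<bar>real_of_int n\<bar> * (2 * pi) < 1 * (2 * pi)" using assms(2) n by (simp add: abs_mult)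
  then have "\<bar>real_of_int n\<bar> < 1" using pi_gt_zero by (subst (asm) mult_less_cancel_right) auto
  then show ?thesis using n by simp
qed

text \<open>A rotation moves a point of the circle other than the endpoints to 1, and the retracted
  chords avoid it. A common point of the retracted chords must lie on both halved copies, and
  doubling it gives a common point of the chords themselves.\<close>

lemma chords_cross:
  assumes f: "path f" "path_image f \<subseteq> cball 0 1" "pathstart f = cis a" "pathfinish f = cis c"
    and g: "path g" "path_image g \<subseteq> cball 0 1" "pathstart g = cis b" "pathfinish g = cis d"
    and ord: "d < c" "c < b" "b < a" "a < d + 2 * pi"
  shows "path_image f \<inter> path_image g \<noteq> {}"
proof -
  \<comment> \<open>The midpoint of the arc from \<open>d\<close> down to \<open>a - 2 * pi\<close>,
    which is free of endpoints; measured from it, all four angles lie strictly between 0 and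
    \<open>2 * pi\<close>.\<close>
  define o' where "o' = (a - 2 * pi + d) / 2"
  have o': "a - 2 * pi < o'" "o' < d" using ord by (auto simp: o'_def field_simps)
  let ?r = "\<lambda>x. cis (- o') * x"
  let ?F = "?r \<circ> retract_chord f" and ?G = "?r \<circ> retract_chord g"
  have ball: "path_image (?r \<circ> retract_chord h) \<subseteq> cball 0 1 - {1}"
    if h: "path_image h \<subseteq> cball 0 1" "pathstart h = cis x" "pathfinish h = cis y"
      and x: "o' < x" "x < o' + 2 * pi" and y: "o' < y" "y < o' + 2 * pi" for h x y
  proof
    \<comment> \<open>Since \<open>0 < x - o' < 2 * pi\<close>, a radial point never has the
      direction of 1 after the rotation.\<close>
    have ne: "cis (- o') * (of_real r * cis x) \<noteq> 1" if "o' < x" "x < o' + 2 * pi" "0 < r" for r x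
    proof
      assume "cis (- o') * (of_real r * cis x) = 1"
      moreover have "cis (x - o') = cis x * cis (- o')" by (simp add: cis_mult)
      ultimately have e: "of_real r * cis (x - o') = 1" by (simp only: mult_ac)
      then have "norm (of_real r * cis (x - o')) = 1" by simp
      then have "r = 1" using that by (simp add: norm_mult)
      with e have "cis (x - o') = 1" by simp
      then show False using cis_eq_1_imp_0[of "x - o'"] that by auto
    qed
    fix z assume "z \<in> path_image (?r \<circ> retract_chord h)"
    then obtain w where w: "w \<in> path_image (retract_chord h)" "z = ?r w"
      by (auto simp: path_image_compose)
    from path_image_retract_chord[OF w(1)]
    show "z \<in> cball 0 1 - {1}"
    proof (elim disjE bexE exE conjE)
      fix v assume v: "v \<in> path_image h" "w = v / 2"
      then have "norm v \<le> 1" using h by auto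
      moreover have "norm z = norm v / 2" unfolding w(2) v(2) by (simp add: norm_mult norm_divide)
      ultimately have "norm z \<le> 1 / 2" by simp
      then have "z \<noteq> 1" by auto
      then show ?thesis using \<open>norm z \<le> 1 / 2\<close> by simp
    next
      fix r v assume r: "1/2 < r" "r \<le> 1" "w = of_real r * v" "v \<in> {pathstart h, pathfinish h}"
      then have v: "v = cis x \<or> v = cis y" using h by auto
      then have "norm v = 1" by auto
      then have "norm z = \<bar>r\<bar>" unfolding w(2) r(3) by (simp add: norm_mult)
      then have "norm z \<le> 1" using r(1,2) by simp
      moreover have "z \<noteq> 1" using v ne[OF x, of r] ne[OF y, of r] r(1) unfolding w(2) r(3) by auto
      ultimately show ?thesis by simp
    qed
  qed
  have "path_image ?F \<inter> path_image ?G \<noteq> {}"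
  proof (rule chords_cross_avoiding_1)
    show "path ?F" "path ?G"
      by (intro path_continuous_image path_retract_chord f g continuous_intros)+
    show "path_image ?F \<subseteq> cball 0 1 - {1}"
      by (rule ball[OF f(2-4)]) (use o' ord in auto)
    show "path_image ?G \<subseteq> cball 0 1 - {1}"
      by (rule ball[OF g(2-4)]) (use o' ord in auto)
    show "pathstart ?F = cis (a - o')" "pathfinish ?F = cis (c - o')"
      "pathstart ?G = cis (b - o')" "pathfinish ?G = cis (d - o')"
      using f g by (simp_all add: pathstart_compose pathfinish_compose cis_mult)
  qed (use ord o' in auto)
  then obtain z where z: "z \<in> path_image (retract_chord f)" "z \<in> path_image (retract_chord g)"
    by (auto simp: path_image_compose)
  \<comment> \<open>Excludes a meeting of two radial pieces: the angles of an endpoint of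
    \<open>f\<close> and one of \<open>g\<close> would agree.\<close>
  have polar: "x = y" if "of_real r * cis x = of_real r' * cis y" "1/2 < r" "1/2 < r'"
    "\<bar>x - y\<bar> < 2 * pi" for r r' x y
  proof -
    have "norm (of_real r * cis x) = norm (of_real r' * cis y)" using that(1) by (rule arg_cong)
    then have "\<bar>r\<bar> = \<bar>r'\<bar>" unfolding norm_mult by simp
    then have "r = r'" using that(2,3) by simp
    then have "cis x = cis y" using that(1,3) by simp
    then have "cis (x - y) = 1" by (simp add: cis_divide[symmetric])
    then show "x = y" using cis_eq_1_imp_0[of "x - y"] that(4) by simp
  qed
  \<comment> \<open>Excludes a meeting of a halved chord with a radial piece: the radii
    differ.\<close>
  have half: False if "w \<in> path_image h" "path_image h \<subseteq> cball 0 1" "z = w / 2"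
    "1/2 < r" "z = of_real r * v" "norm v = 1" for w h r v
  proof -
    have "norm w \<le> 1" using that(1,2) by auto
    then have "norm z \<le> 1/2" unfolding that(3) by (simp add: norm_divide)
    moreover have "norm z = r" unfolding that(5) using that(4,6) by (simp add: norm_mult)
    ultimately show False using that(4) by simp
  qed
  from path_image_retract_chord[OF z(1)] path_image_retract_chord[OF z(2)]
  show ?thesis
  proof (elim disjE bexE exE conjE)
    fix v w assume "v \<in> path_image f" "z = v / 2" "w \<in> path_image g" "z = w / 2"
    then show ?thesis by auto
  next
    fix v r w assume "v \<in> path_image f" "z = v / 2" "1/2 < r" "r \<le> 1"
      "z = of_real r * w" "w \<in> {pathstart g, pathfinish g}"
    moreover from this have "norm w = 1" using g by auto
    ultimately show ?thesis using half f(2) by blast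
  next
    fix v r w assume "v \<in> path_image g" "z = v / 2" "1/2 < r" "r \<le> 1"
      "z = of_real r * w" "w \<in> {pathstart f, pathfinish f}"
    moreover from this have "norm w = 1" using f by auto
    ultimately show ?thesis using half g(2) by blast
  next
    fix r v r' w assume r: "1/2 < r" "r \<le> 1" "z = of_real r * v" "v \<in> {pathstart f, pathfinish f}"
      "1/2 < r'" "r' \<le> 1" "z = of_real r' * w" "w \<in> {pathstart g, pathfinish g}"
    then obtain x y where xy: "v = cis x" "w = cis y" "x \<in> {a, c}" "y \<in> {b, d}"
      using f g by auto
    then have "x = y" by (intro polar[of r x r' y]) (use r ord in auto)
    then show ?thesis using xy ord by auto
  qed
qed

section \<open>Permanents and determinants over finite index sets\<close>

text \<open>Reindexing along the involution \<open>h\<close> gives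
  \<open>sum f S = - sum f S\<close>, which forces 0 in an ordered ring. At a fixed point of
  \<open>h\<close> the value of \<open>f\<close> is 0 for the same reason.\<close>

lemma sum_sign_reversing:
  fixes f :: "'a \<Rightarrow> 'b::linordered_idom"
  assumes "\<And>x. x \<in> S \<Longrightarrow> h x \<in> S" "\<And>x. x \<in> S \<Longrightarrow> h (h x) = x"
    and "\<And>x. x \<in> S \<Longrightarrow> f (h x) = - f x"
  shows "sum f S = 0"
proof -
  have "sum f S = (\<Sum>x\<in>S. - f x)"
    by (rule sum.reindex_bij_witness[of _ h h]) (use assms in auto)
  then show ?thesis by (simp add: sum_negf)
qed

definition perm_on :: "'i set \<Rightarrow> ('i \<Rightarrow> 'i \<Rightarrow> 'a::comm_ring_1) \<Rightarrow> 'a" where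
  "perm_on U A = (\<Sum>w | w permutes U. \<Prod>i\<in>U. A i (w i))"

definition det_on :: "'i set \<Rightarrow> ('i \<Rightarrow> 'i \<Rightarrow> 'a::comm_ring_1) \<Rightarrow> 'a" where
  "det_on U A = (\<Sum>w | w permutes U. of_int (sign w) * (\<Prod>i\<in>U. A i (w i)))"

section \<open>Subsets invariant under a permutation, and Muir's identity\<close>

lemma permutes_invariant_mem:
  assumes "w permutes U" "w ` B = B"
  shows "w x \<in> B \<longleftrightarrow> x \<in> B"
  using assms by (metis image_iff permutes_inj inj_eq)

text \<open>The composition sends the predecessor of \<open>u\<close> directly to \<open>w u\<close>
  and fixes \<open>u\<close>, which short-circuits \<open>u\<close> out of its cycle.\<close>

lemma permutes_remove_point:
  assumes "w permutes U" "u \<in> U"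
  shows "(Transposition.transpose u (w u) \<circ> w) permutes (U - {u})"
  using permutes_insert_lemma[of w u "U - {u}"] assms
  by (simp add: insert_absorb)

text \<open>Induction on \<open>U\<close>: a fixed point \<open>u\<close> of \<open>w\<close> may be added to or removed from \<open>B\<close>,
  and a point \<open>u\<close> that is not fixed may be short-circuited out of its cycle.\<close>

lemma sum_invariant_sets_sign:
  assumes "finite U" "U \<noteq> {}" "w permutes U"
  shows "(\<Sum>B | B \<subseteq> U \<and> w ` B = B. (- 1) ^ card B * sign_on B w) = 0"
  using assms
proof (induction U arbitrary: w rule: finite_psubset_induct)
  case (psubset U)
  let ?f = "\<lambda>w B. (- 1) ^ card B * sign_on B w"
  have inj: "inj w" using psubset.prems permutes_inj by blast
  obtain u where u: "u \<in> U" using psubset.prems by auto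
  show ?case
  proof (cases "w u = u")
    case True
    \<comment> \<open>Toggling the fixed point \<open>u\<close> leaves the restricted permutation
      alone and changes the parity of the cardinality.\<close>
    let ?h = "\<lambda>B. if u \<in> B then B - {u} else insert u B"
    show ?thesis
    proof (rule sum_sign_reversing[of _ ?h])
      fix B assume B: "B \<in> {B. B \<subseteq> U \<and> w ` B = B}"
      then have fin: "finite B" using psubset.hyps(1) finite_subset by blast
      show "?h B \<in> {B. B \<subseteq> U \<and> w ` B = B}"
        using B True u inj by (auto simp: image_set_diff)
      show "?h (?h B) = B" by auto
      have "restrict_id w (?h B) = restrict_id w B"
        using True by (auto simp: restrict_id_def fun_eq_iff)
      moreover have "(- 1) ^ card (?h B) = - ((- 1) ^ card B :: int)"
      proof (cases "u \<in> B")
        case True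
        then have "card B = Suc (card (B - {u}))" using fin by (metis card.remove)
        then show ?thesis using True by (simp del: card_Diff_insert card_Diff_singleton)
      qed (use fin in simp)
      ultimately show "?f w (?h B) = - ?f w B" by (simp add: sign_on_def del: restrict_id_cong)
    qed
  next
    case False
    define v where "v = w u"
    define \<tau> where "\<tau> = Transposition.transpose u v"
    define w' where "w' = \<tau> \<circ> w"
    have v: "v \<in> U" "v \<noteq> u" using False u psubset.prems by (auto simp: v_def permutes_in_image)
    have w': "w' permutes (U - {u})"
      using permutes_remove_point[OF psubset.prems(2) u] by (simp add: w'_def \<tau>_def v_def)
    have \<tau>: "\<tau> u = v" "\<tau> v = u" "\<And>x. x \<noteq> u \<Longrightarrow> x \<noteq> v \<Longrightarrow> \<tau> x = x" "\<And>x. \<tau> (\<tau> x) = x"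
      by (auto simp: \<tau>_def)
    have w_w': "w x = \<tau> (w' x)" for x by (simp add: w'_def \<tau>)
    \<comment> \<open>\<open>u\<close> and \<open>v\<close> lie on the same cycle of
      \<open>w\<close>, so an invariant set contains both or neither.\<close>
    have uv: "u \<in> B \<longleftrightarrow> v \<in> B" if "w ` B = B" for B
      using permutes_invariant_mem[OF psubset.prems(2) that, of u] by (simp add: v_def)
    have image_\<tau>: "\<tau> ` B = B" if "u \<in> B \<longleftrightarrow> v \<in> B" for B
      using that by (simp add: \<tau>_def)
    have image_\<tau>': "\<tau> ` (B - {v}) = B - {u}" if "u \<in> B \<longleftrightarrow> v \<in> B" for B
    proof -
      have "\<tau> ` (B - {v}) = \<tau> ` B - \<tau> ` {v}"
        by (rule image_set_diff) (simp add: \<tau>_def)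
      then show ?thesis by (simp add: image_\<tau>[OF that] \<tau>)
    qed
    \<comment> \<open>This is the inverse of removing \<open>u\<close>, from the
      \<open>w'\<close>-invariant sets back to the \<open>w\<close>-invariant ones. If
      \<open>u\<close> is really removed, one element and one transposition disappear, and the two
      sign changes cancel.\<close>
    let ?h = "\<lambda>B. if v \<in> B then insert u B else B"
    have "(\<Sum>B | B \<subseteq> U \<and> w ` B = B. ?f w B) = (\<Sum>B | B \<subseteq> U - {u} \<and> w' ` B = B. ?f w' B)"
    proof (rule sum.reindex_bij_witness[of _ ?h "\<lambda>B. B - {u}"])
      fix B assume B: "B \<in> {B. B \<subseteq> U \<and> w ` B = B}"
      then have wB: "w ` B = B" and BU: "B \<subseteq> U" by auto
      then have fin: "finite B" using psubset.hyps(1) finite_subset by blast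
      note mem = permutes_invariant_mem[OF psubset.prems(2) wB]
      have uvB: "u \<in> B \<longleftrightarrow> v \<in> B" using uv wB by blast
      show "?h (B - {u}) = B" using uvB v by auto
      have "w' ` (B - {u}) = \<tau> ` (w ` (B - {u}))" by (simp add: w'_def image_comp)
      also have "w ` (B - {u}) = B - {v}" using inj wB by (simp add: image_set_diff v_def)
      finally have w'B: "w' ` (B - {u}) = B - {u}" using image_\<tau>'[OF uvB] by simp
      then show "B - {u} \<in> {B. B \<subseteq> U - {u} \<and> w' ` B = B}" using BU by auto
      show "?f w' (B - {u}) = ?f w B"
      proof (cases "u \<in> B")
        case True
        then have "v \<in> B" using uvB by simp
        have "restrict_id w B = \<tau> \<circ> restrict_id w' (B - {u})"
        proof
          fix x
          show "restrict_id w B x = (\<tau> \<circ> restrict_id w' (B - {u})) x"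
          proof (cases "x \<in> B")
            case True
            then show ?thesis using \<tau>(1) w_w'[of x] by (cases "x = u") (simp_all add: v_def)
          next
            case False
            then have "x \<noteq> u" "x \<noteq> v" using \<open>u \<in> B\<close> \<open>v \<in> B\<close> by auto
            then show ?thesis using False \<tau>(3) by simp
          qed
        qed
        moreover have "permutation (restrict_id w' (B - {u}))"
          using fin w'B permutes_restrict_id[of w' "B - {u}"] permutes_inj_on[OF w']
          by (intro permutes_imp_permutation[of "B - {u}"]) (auto simp: bij_betw_def)
        ultimately have "sign_on B w = - sign_on (B - {u}) w'"
          using sign_compose[of \<tau> "restrict_id w' (B - {u})"] v
          unfolding sign_on_def \<tau>_def by (simp add: permutation_swap_id sign_swap_id)
        moreover have "card B = Suc (card (B - {u}))" using fin True by (metis card.remove)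
        ultimately show ?thesis by simp
      next
        case False
        have "restrict_id w' (B - {u}) = restrict_id w B"
        proof
          fix x
          have "x \<in> B \<Longrightarrow> w x \<noteq> u \<and> w x \<noteq> v" using mem False uvB by metis
          then show "restrict_id w' (B - {u}) x = restrict_id w B x"
            using False \<tau>(3)[of "w x"] by (cases "x \<in> B") (auto simp: w'_def)
        qed
        then show ?thesis using False by (simp add: sign_on_def del: restrict_id_cong)
      qed
    next
      fix B assume B: "B \<in> {B. B \<subseteq> U - {u} \<and> w' ` B = B}"
      then have uB: "u \<notin> B" and w'B: "w' ` B = B" by auto
      show "?h B - {u} = B" using uB by auto
      have "w ` ?h B = ?h B"
      proof (cases "v \<in> B")
        case True
        have "w ` insert u B = insert v (\<tau> ` (w' ` B))"
          unfolding image_insert v_def[symmetric] by (simp only: image_image w_w'[symmetric])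
        also have "\<dots> = insert v (\<tau> ` (insert u B - {u}))" using w'B uB by simp
        also have "insert u B - {u} = \<tau> ` (insert u B - {v})"
          using image_\<tau>'[of "insert u B"] True by simp
        also have "\<tau> ` (\<tau> ` (insert u B - {v})) = insert u B - {v}"
          by (simp add: image_image \<tau>)
        finally show ?thesis using True by auto
      next
        case False
        have "w ` B = \<tau> ` (w' ` B)" by (simp only: image_image w_w'[symmetric])
        then show ?thesis using False image_\<tau>[of B] uB w'B by simp
      qed
      then show "?h B \<in> {B. B \<subseteq> U \<and> w ` B = B}" using B u by auto
    qed
    \<comment> \<open>\<open>v\<close> remains in \<open>U - {u}\<close>, so the induction
      hypothesis applies to a nonempty set.\<close>
    also have "\<dots> = 0" using psubset.IH[OF _ _ w'] u v by blast
    finally show ?thesis .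
  qed
qed

text \<open>A permutation of \<open>U\<close> that preserves \<open>B\<close> amounts to a
  permutation of \<open>B\<close> and one of \<open>U - B\<close>: restriction yields the pair,
  composition undoes it.\<close>

lemma sum_permutes_prod_split:
  fixes f g :: "('i \<Rightarrow> 'i) \<Rightarrow> 'a::comm_semiring_1"
  assumes "finite U" "B \<subseteq> U"
  shows "(\<Sum>p | p permutes B. f p) * (\<Sum>q | q permutes (U - B). g q) =
    (\<Sum>w | w permutes U \<and> w ` B = B. f (restrict_id w B) * g (restrict_id w (U - B)))"
proof -
  have rest: "bij_betw w B B \<and> bij_betw w (U - B) (U - B)"
    if "w permutes U" "w ` B = B" for w
  proof -
    have "inj w" "w ` U = U" using that permutes_inj permutes_image by blast+
    then show ?thesis using that by (auto simp: bij_betw_def image_set_diff inj_on_def)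
  qed
  have "(\<Sum>p | p permutes B. f p) * (\<Sum>q | q permutes (U - B). g q) =
      (\<Sum>(p, q)\<in>{p. p permutes B} \<times> {q. q permutes (U - B)}. f p * g q)"
    by (simp add: sum_product sum.cartesian_product)
  also have "\<dots> = (\<Sum>w | w permutes U \<and> w ` B = B. f (restrict_id w B) * g (restrict_id w (U - B)))"
  proof (rule sum.reindex_bij_witness[of _
        "\<lambda>w. (restrict_id w B, restrict_id w (U - B))" "\<lambda>(p, q). p \<circ> q"])
    fix w assume w: "w \<in> {w. w permutes U \<and> w ` B = B}"
    then have wU: "w permutes U" and mem: "\<And>x. w x \<in> B \<longleftrightarrow> x \<in> B"
      using permutes_invariant_mem by fastforce+
    show "(case (restrict_id w B, restrict_id w (U - B)) of (p, q) \<Rightarrow> p \<circ> q) = w"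
      using permutes_not_in[OF wU] mem assms(2) by (auto simp: restrict_id_def fun_eq_iff)
    show "(restrict_id w B, restrict_id w (U - B)) \<in> {p. p permutes B} \<times> {q. q permutes (U - B)}"
      using rest[of w] w by (auto intro!: permutes_restrict_id)
  next
    fix pq assume "pq \<in> {p. p permutes B} \<times> {q. q permutes (U - B)}"
    then obtain p q where pq: "pq = (p, q)" "p permutes B" "q permutes (U - B)" by auto
    have q: "q x = x" if "x \<in> B" for x using pq that by (simp add: permutes_not_in)
    have qm: "q x \<in> U - B \<longleftrightarrow> x \<in> U - B" for x
      using permutes_in_image[OF pq(3)] .
    have p: "p x = x" if "x \<notin> B" for x using pq that by (simp add: permutes_not_in)
    have qB: "q x \<notin> B" if "x \<notin> B" for x using that qm q pq(3) by (metis DiffI permutes_not_in DiffD2)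
    have r: "restrict_id (p \<circ> q) B = p" using q p by (auto simp: restrict_id_def fun_eq_iff)
    have r': "restrict_id (p \<circ> q) (U - B) = q"
      using qB p pq(3) by (auto simp: restrict_id_def fun_eq_iff permutes_not_in)
    show "(restrict_id (case pq of (p, q) \<Rightarrow> p \<circ> q) B,
        restrict_id (case pq of (p, q) \<Rightarrow> p \<circ> q) (U - B)) = pq"
      using pq r r' by (simp del: restrict_id_cong)
    have "p \<circ> q permutes U"
      using pq assms(2) by (intro permutes_compose) (auto intro: permutes_subset)
    moreover have "(p \<circ> q) ` B = B"
      using permutes_image[OF pq(2)] image_cong[of B B q id] q by (simp add: image_comp[symmetric])
    ultimately show "(case pq of (p, q) \<Rightarrow> p \<circ> q) \<in> {w. w permutes U \<and> w ` B = B}"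
      using pq by simp
    show "f (restrict_id (case pq of (p, q) \<Rightarrow> p \<circ> q) B) *
        g (restrict_id (case pq of (p, q) \<Rightarrow> p \<circ> q) (U - B)) = (case pq of (p, q) \<Rightarrow> f p * g q)"
      using pq r r' by (simp del: restrict_id_cong)
  qed
  finally show ?thesis .
qed

text \<open>Expanded, the term of \<open>B\<close> runs over the permutations \<open>w\<close> that
  preserve \<open>B\<close>, each with its full monomial. After exchanging the sums, the coefficient
  of a monomial is a signed count of unions of cycles of \<open>w\<close>. A cycle of length
  \<open>l\<close> contributes \<open>(-1)^l * (-1)^(l-1) = -1\<close> when it is included and 1
  otherwise, so the count is a product of factors \<open>1 - 1\<close>.\<close>

lemma Muir_identity:
  fixes A :: "'i \<Rightarrow> 'i \<Rightarrow> 'a::comm_ring_1"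
  assumes fin: "finite U" and "U \<noteq> {}"
  shows "(\<Sum>B\<in>Pow U. (- 1) ^ card B * det_on B A * perm_on (U - B) A) = 0"
proof -
  let ?P = "{w. w permutes U}"
  have "(\<Sum>B\<in>Pow U. (- 1) ^ card B * det_on B A * perm_on (U - B) A) =
    (\<Sum>B\<in>Pow U. \<Sum>w | w \<in> ?P \<and> w ` B = B.
       of_int ((- 1) ^ card B * sign_on B w) * (\<Prod>i\<in>U. A i (w i)))"
  proof (rule sum.cong[OF refl])
    fix B assume "B \<in> Pow U"
    then have B: "B \<subseteq> U" by simp
    have "det_on B A * perm_on (U - B) A =
      (\<Sum>w | w permutes U \<and> w ` B = B. of_int (sign (restrict_id w B)) *
        (\<Prod>i\<in>B. A i (restrict_id w B i)) * (\<Prod>i\<in>U - B. A i (restrict_id w (U - B) i)))"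
      unfolding det_on_def perm_on_def by (rule sum_permutes_prod_split[OF fin B])
    also have "\<dots> = (\<Sum>w | w permutes U \<and> w ` B = B. of_int (sign_on B w) * (\<Prod>i\<in>U. A i (w i)))"
    proof (rule sum.cong[OF refl])
      fix w
      have "(\<Prod>i\<in>B. A i (restrict_id w B i)) * (\<Prod>i\<in>U - B. A i (restrict_id w (U - B) i)) =
          (\<Prod>i\<in>B. A i (w i)) * (\<Prod>i\<in>U - B. A i (w i))" by simp
      also have "\<dots> = (\<Prod>i\<in>U. A i (w i))" by (metis mult.commute prod.subset_diff[OF B fin])
      finally show "of_int (sign (restrict_id w B)) * (\<Prod>i\<in>B. A i (restrict_id w B i)) *
          (\<Prod>i\<in>U - B. A i (restrict_id w (U - B) i)) = of_int (sign_on B w) * (\<Prod>i\<in>U. A i (w i))"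
        by (simp add: sign_on_def mult.assoc del: restrict_id_cong)
    qed
    finally show "(- 1) ^ card B * det_on B A * perm_on (U - B) A = (\<Sum>w | w \<in> ?P \<and> w ` B = B.
       of_int ((- 1) ^ card B * sign_on B w) * (\<Prod>i\<in>U. A i (w i)))"
      by (simp add: sum_distrib_left mult.assoc)
  qed
  also have "\<dots> = (\<Sum>w\<in>?P. \<Sum>B | B \<in> Pow U \<and> w ` B = B.
       of_int ((- 1) ^ card B * sign_on B w) * (\<Prod>i\<in>U. A i (w i)))"
    using fin by (intro sum.swap_restrict) (auto simp: finite_permutations)
  also have "\<dots> = (\<Sum>w\<in>?P. of_int (\<Sum>B | B \<subseteq> U \<and> w ` B = B. (- 1) ^ card B * sign_on B w) *
       (\<Prod>i\<in>U. A i (w i)))"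
    by (simp add: sum_distrib_right)
  also have "\<dots> = 0"
    using sum_invariant_sets_sign[OF assms] by (intro sum.neutral) simp
  finally show ?thesis .
qed

section \<open>The determinant of the 0/1 matrix of a poset\<close>

lemma det_on_equal_rows:
  fixes A :: "'i \<Rightarrow> 'i \<Rightarrow> 'a::linordered_idom"
  assumes "finite B" "a \<in> B" "b \<in> B" "a \<noteq> b" and eq: "\<And>j. j \<in> B \<Longrightarrow> A a j = A b j"
  shows "det_on B A = 0"
  unfolding det_on_def
proof (rule sum_sign_reversing)
  \<comment> \<open>Precomposing with this transposition reverses the sign of \<open>w\<close>, and
    preserves the product because rows \<open>a\<close> and \<open>b\<close> agree.\<close>
  let ?t = "Transposition.transpose a b"
  fix w assume "w \<in> {w. w permutes B}"
  then have w: "w permutes B" by simp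
  have t: "?t permutes B" using assms by (simp add: permutes_swap_id)
  show "w \<circ> ?t \<in> {w. w permutes B}" using w t permutes_compose by blast
  show "(w \<circ> ?t) \<circ> ?t = w" by (simp add: comp_assoc)
  have "sign (w \<circ> ?t) = - sign w"
    using \<open>a \<noteq> b\<close> sign_compose[OF permutes_imp_permutation[OF \<open>finite B\<close> w] permutation_swap_id]
    by (simp add: sign_swap_id)
  moreover have "(\<Prod>i\<in>B. A i ((w \<circ> ?t) i)) = (\<Prod>i\<in>B. A i (w i))"
  proof -
    have row: "A (?t i) (w i) = A i (w i)" if "i \<in> B" for i
    proof -
      have "A a (w i) = A b (w i)" using eq permutes_in_image[OF w] that by blast
      then show ?thesis by (auto simp: Transposition.transpose_def)
    qed
    have "(\<Prod>i\<in>B. A i ((w \<circ> ?t) i)) = (\<Prod>i\<in>B. A (?t i) ((w \<circ> ?t) (?t i)))"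
      using prod.permute[OF t, of "\<lambda>i. A i ((w \<circ> ?t) i)"] unfolding o_def .
    also have "\<dots> = (\<Prod>i\<in>B. A i (w i))" by (intro prod.cong) (simp_all only: o_apply transpose_involutory row)
    finally show ?thesis .
  qed
  ultimately show "of_int (sign (w \<circ> ?t)) * (\<Prod>i\<in>B. A i ((w \<circ> ?t) i)) =
      - (of_int (sign w) * (\<Prod>i\<in>B. A i (w i)))" by (simp only: of_int_minus mult_minus_left)
qed

text \<open>A permutation that reaches \<open>m\<close> from elsewhere has a zero factor, so only
  those fixing \<open>m\<close> contribute, with the factor \<open>A m m = 1\<close>.\<close>

lemma det_on_unit_column:
  fixes A :: "'i \<Rightarrow> 'i \<Rightarrow> 'a::comm_ring_1"
  assumes "finite B" "m \<in> B" "A m m = 1" and zero: "\<And>i. i \<in> B - {m} \<Longrightarrow> A i m = 0"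
  shows "det_on B A = det_on (B - {m}) A"
proof -
  have "det_on B A = (\<Sum>w | w permutes B - {m}. of_int (sign w) * (\<Prod>i\<in>B. A i (w i)))"
    unfolding det_on_def
  proof (rule sum.mono_neutral_right)
    show "{w. w permutes B - {m}} \<subseteq> {w. w permutes B}"
      using permutes_subset by fastforce
    show "\<forall>w\<in>{w. w permutes B} - {w. w permutes B - {m}}. of_int (sign w) * (\<Prod>i\<in>B. A i (w i)) = 0"
    proof
      fix w assume w: "w \<in> {w. w permutes B} - {w. w permutes B - {m}}"
      then have wB: "w permutes B" by simp
      obtain i where i: "i \<in> B" "w i = m"
        using permutes_image[OF wB] \<open>m \<in> B\<close> by (metis imageE)
      have "i \<noteq> m"
      proof
        assume "i = m"
        then have "w permutes B - {m}"
          using i permutes_superset[OF wB, of "B - {m}"] by auto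
        then show False using w by simp
      qed
      then have "A i (w i) = 0" using i zero by simp
      then have "(\<Prod>i\<in>B. A i (w i)) = 0" using i(1) by (intro prod_zero[OF \<open>finite B\<close>] bexI)
      then show "of_int (sign w) * (\<Prod>i\<in>B. A i (w i)) = 0" by simp
    qed
  qed (use \<open>finite B\<close> in \<open>simp add: finite_permutations\<close>)
  also have "\<dots> = det_on (B - {m}) A"
    unfolding det_on_def
  proof (rule sum.cong[OF refl])
    fix w assume "w \<in> {w. w permutes B - {m}}"
    then have "w m = m" by (intro permutes_not_in) auto
    then show "of_int (sign w) * (\<Prod>i\<in>B. A i (w i)) = of_int (sign w) * (\<Prod>i\<in>B - {m}. A i (w i))"
      using assms(1-3) prod.remove[of B m "\<lambda>i. A i (w i)"] by simp
  qed
  finally show ?thesis .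
qed

text \<open>Two maximal elements yield equal rows; a unique maximal element is a maximum, and its
  column is a unit vector.\<close>

lemma det_on_poset_matrix:
  fixes less :: "'i \<Rightarrow> 'i \<Rightarrow> bool"
  assumes "finite B"
    and irrefl: "\<And>i. i \<in> B \<Longrightarrow> \<not> less i i"
    and trans: "\<And>i j k. i \<in> B \<Longrightarrow> j \<in> B \<Longrightarrow> k \<in> B \<Longrightarrow> less i j \<Longrightarrow> less j k \<Longrightarrow> less i k"
  shows "det_on B (\<lambda>i j. of_bool (\<not> less i j) :: 'a::linordered_idom) =
    of_bool (\<forall>i\<in>B. \<forall>j\<in>B. i \<noteq> j \<longrightarrow> less i j \<or> less j i)"
  using assms
proof (induction B rule: finite_psubset_induct)
  case (psubset B)
  let ?A = "\<lambda>i j. of_bool (\<not> less i j) :: 'a"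
  let ?C = "\<lambda>B. \<forall>i\<in>B. \<forall>j\<in>B. i \<noteq> j \<longrightarrow> less i j \<or> less j i"
  define M where "M = {m\<in>B. \<forall>j\<in>B. \<not> less m j}"
  \<comment> \<open>Finiteness gives a maximal element among those weakly above \<open>i\<close>; by
    transitivity it is maximal in all of \<open>B\<close>.\<close>
  have above: "i \<in> M \<or> (\<exists>m\<in>M. less i m)" if "i \<in> B" for i
  proof -
    have "\<exists>m\<in>S. \<forall>j\<in>S. \<not> less m j" if "finite S" "S \<noteq> {}" "S \<subseteq> B" for S
      using that
    proof (induction S rule: finite_ne_induct)
      case (singleton x)
      then show ?case using psubset.prems(1) by auto
    next
      case (insert x S)
      then obtain m where m: "m \<in> S" "\<forall>j\<in>S. \<not> less m j" by auto
      show ?case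
      proof (cases "less m x")
        case True
        have "\<not> less x j" if "j \<in> insert x S" for j
          using that True m insert.prems psubset.prems by (metis insert_iff subsetD)
        then show ?thesis by blast
      qed (use m in auto)
    qed
    moreover have "finite {j\<in>B. j = i \<or> less i j}" "i \<in> {j\<in>B. j = i \<or> less i j}"
      using psubset.hyps(1) that by simp_all
    ultimately have "\<exists>m\<in>{j\<in>B. j = i \<or> less i j}. \<forall>j\<in>{j\<in>B. j = i \<or> less i j}. \<not> less m j"
      by (metis (no_types, lifting) empty_iff mem_Collect_eq subsetI)
    then obtain m where
      m: "m \<in> B" "m = i \<or> less i m" "\<And>j. j \<in> B \<Longrightarrow> j = i \<or> less i j \<Longrightarrow> \<not> less m j"
      by blast
    then have "m \<in> M" using psubset.prems(2)[of i m] that unfolding M_def by blast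
    then show ?thesis using m by auto
  qed
  show ?case
  proof (cases "\<exists>a\<in>M. \<exists>b\<in>M. a \<noteq> b")
    case True
    then obtain a b where ab: "a \<in> M" "b \<in> M" "a \<noteq> b" by auto
    then have "det_on B ?A = 0"
      using psubset.hyps by (intro det_on_equal_rows[of B a b]) (auto simp: M_def)
    moreover have "\<not> ?C B" using ab by (auto simp: M_def)
    ultimately show ?thesis by simp
  next
    case False
    show ?thesis
    proof (cases "B = {}")
      case True
      then show ?thesis by (simp add: det_on_def)
    next
      case nonempty: False
      then obtain m where m: "m \<in> M" using above by blast
      then have mB: "m \<in> B" by (simp add: M_def)
      have "M = {m}" using m False by auto
      have max: "less i m" if "i \<in> B - {m}" for i
        using above[of i] that \<open>M = {m}\<close> by auto
      have "det_on B ?A = det_on (B - {m}) ?A"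
        using psubset.hyps mB max psubset.prems(1) by (intro det_on_unit_column) auto
      also have "\<dots> = of_bool (?C (B - {m}))"
        using mB psubset.prems by (intro psubset.IH) blast+
      \<comment> \<open>The maximum \<open>m\<close> is comparable with every other element, so its
        removal does not affect being a chain.\<close>
      also have "?C (B - {m}) = ?C B" using max by blast
      finally show ?thesis .
    qed
  qed
qed

lemma det_on_cong:
  assumes "\<And>i j. i \<in> B \<Longrightarrow> j \<in> B \<Longrightarrow> A i j = A' i j"
  shows "det_on B A = det_on B A'"
  unfolding det_on_def
proof (rule sum.cong[OF refl])
  fix w assume "w \<in> {w. w permutes B}"
  then have "(\<Prod>i\<in>B. A i (w i)) = (\<Prod>i\<in>B. A' i (w i))"
    using assms by (intro prod.cong) (auto simp: permutes_in_image)
  then show "of_int (sign w) * (\<Prod>i\<in>B. A i (w i)) = of_int (sign w) * (\<Prod>i\<in>B. A' i (w i))"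
    by simp
qed

lemma perm_on_cong:
  assumes "\<And>i j. i \<in> B \<Longrightarrow> j \<in> B \<Longrightarrow> A i j = A' i j"
  shows "perm_on B A = perm_on B A'"
  unfolding perm_on_def using assms by (intro sum.cong prod.cong) (auto simp: permutes_in_image)

text \<open>The term \<open>B = {}\<close> of Muir's identity is \<open>perm_on U A\<close> itself;
  the other terms involve permanents over proper subsets of \<open>U\<close> only.\<close>

lemma perm_on_recursion:
  fixes A :: "'i \<Rightarrow> 'i \<Rightarrow> 'a::comm_ring_1"
  assumes "finite U" "U \<noteq> {}"
  shows "perm_on U A = - (\<Sum>B\<in>Pow U - {{}}. (- 1) ^ card B * det_on B A * perm_on (U - B) A)"
proof -
  let ?f = "\<lambda>B. (- 1) ^ card B * det_on B A * perm_on (U - B) A"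
  have "0 = ?f {} + sum ?f (Pow U - {{}})"
    using Muir_identity[OF assms, of A] sum.remove[of "Pow U" "{}" ?f] assms(1) by simp
  then show ?thesis by (simp add: det_on_def eq_neg_iff_add_eq_0)
qed

text \<open>A family on \<open>U\<close> is the same as its restrictions to \<open>B\<close> and
  \<open>U - B\<close>. This merges the minor and the complementary permanent into one sum over
  families.\<close>

lemma sum_PiE_split:
  fixes f g :: "('i \<Rightarrow> 'b) \<Rightarrow> 'c::comm_semiring_0"
  assumes "B \<subseteq> U"
  shows "(\<Sum>\<pi>\<in>Pi\<^sub>E U P. f (restrict \<pi> B) * g (restrict \<pi> (U - B))) =
    (\<Sum>\<pi>\<in>Pi\<^sub>E B P. f \<pi>) * (\<Sum>\<pi>\<in>Pi\<^sub>E (U - B) P. g \<pi>)"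
proof -
  have "(\<Sum>\<pi>\<in>Pi\<^sub>E B P. f \<pi>) * (\<Sum>\<pi>\<in>Pi\<^sub>E (U - B) P. g \<pi>) =
      (\<Sum>(\<rho>, \<sigma>)\<in>Pi\<^sub>E B P \<times> Pi\<^sub>E (U - B) P. f \<rho> * g \<sigma>)"
    by (simp add: sum_product sum.cartesian_product)
  also have "\<dots> = (\<Sum>\<pi>\<in>Pi\<^sub>E U P. f (restrict \<pi> B) * g (restrict \<pi> (U - B)))"
  proof (rule sum.reindex_bij_witness[of _ "\<lambda>\<pi>. (restrict \<pi> B, restrict \<pi> (U - B))"
        "\<lambda>(\<rho>, \<sigma>) i. if i \<in> B then \<rho> i else \<sigma> i"])
    fix z assume z: "z \<in> Pi\<^sub>E B P \<times> Pi\<^sub>E (U - B) P"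
    obtain \<rho> \<sigma> where [simp]: "z = (\<rho>, \<sigma>)" by (cases z)
    let ?\<pi> = "\<lambda>i. if i \<in> B then \<rho> i else \<sigma> i"
    have \<rho>: "\<rho> \<in> Pi\<^sub>E B P" and \<sigma>: "\<sigma> \<in> Pi\<^sub>E (U - B) P" using z by auto
    have 1: "restrict ?\<pi> B = \<rho>" using \<rho> by (auto simp: fun_eq_iff restrict_def PiE_def extensional_def)
    have 2: "restrict ?\<pi> (U - B) = \<sigma>"
      using \<sigma> by (auto simp: fun_eq_iff restrict_def PiE_def extensional_def)
    show "(restrict (case z of (\<rho>, \<sigma>) \<Rightarrow> \<lambda>i. if i \<in> B then \<rho> i else \<sigma> i) B,
        restrict (case z of (\<rho>, \<sigma>) \<Rightarrow> \<lambda>i. if i \<in> B then \<rho> i else \<sigma> i) (U - B)) = z"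
      using 1 2 by simp
    show "(case z of (\<rho>, \<sigma>) \<Rightarrow> \<lambda>i. if i \<in> B then \<rho> i else \<sigma> i) \<in> Pi\<^sub>E U P"
      using \<rho> \<sigma> assms by (auto simp: PiE_def Pi_def extensional_def)
    show "f (restrict (case z of (\<rho>, \<sigma>) \<Rightarrow> \<lambda>i. if i \<in> B then \<rho> i else \<sigma> i) B) *
        g (restrict (case z of (\<rho>, \<sigma>) \<Rightarrow> \<lambda>i. if i \<in> B then \<rho> i else \<sigma> i) (U - B)) =
        (case z of (\<rho>, \<sigma>) \<Rightarrow> f \<rho> * g \<sigma>)"
      using 1 2 by simp
  next
    fix \<pi> assume \<pi>: "\<pi> \<in> Pi\<^sub>E U P"
    show "(case (restrict \<pi> B, restrict \<pi> (U - B)) of (\<rho>, \<sigma>) \<Rightarrow> \<lambda>i. if i \<in> B then \<rho> i else \<sigma> i) = \<pi>"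
      using \<pi> assms by (auto simp: fun_eq_iff PiE_def extensional_def)
    show "(restrict \<pi> B, restrict \<pi> (U - B)) \<in> Pi\<^sub>E B P \<times> Pi\<^sub>E (U - B) P"
      using \<pi> assms by auto
  qed
  finally show ?thesis by simp
qed

text \<open>Take the least moved point \<open>i\<close> and its preimage \<open>j\<close>. All
  values below \<open>i\<close> are taken by points below \<open>i\<close>, so \<open>i < j\<close>
  and \<open>w j = i < w i\<close>.\<close>

lemma permutes_inversion:
  fixes w :: "nat \<Rightarrow> nat"
  assumes "w permutes B" "w \<noteq> id"
  obtains i j where "i \<in> B" "j \<in> B" "i < j" "w j < w i"
proof -
  define i where "i = (LEAST i. w i \<noteq> i)"
  have "\<exists>i. w i \<noteq> i" using assms(2) by (auto simp: fun_eq_iff)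
  then have i: "w i \<noteq> i" unfolding i_def by (rule LeastI_ex)
  have least: "w k = k" if "k < i" for k
    using that not_less_Least unfolding i_def by blast
  obtain j where j: "w j = i" using permutes_surj[OF assms(1)] by (metis surjD)
  have "inj w" using assms(1) by (rule permutes_inj)
  have "i \<le> w i" using least[of "w i"] i \<open>inj w\<close> by (metis injD not_le)
  moreover have "i \<le> j" using least[of j] j by (cases "j < i") auto
  moreover have "j \<noteq> i" using i j by auto
  moreover have "i \<in> B" using i assms(1) permutes_not_in by metis
  moreover have "j \<in> B" using j \<open>j \<noteq> i\<close> assms(1) permutes_not_in by metis
  ultimately show ?thesis using that[of i j] i j by simp
qed

section \<open>Tail swapping in acyclic digraphs\<close>

locale acyclic_digraph = fin_digraph D for D :: "('a, 'b) pre_digraph" +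
  assumes acyclic: "acyclic (arcs_ends D)"
begin

text \<open>A repeated vertex would enclose a nonempty closed walk. Hence walks pasted from pieces
  of paths are paths again.\<close>

lemma apath_iff_awalk: "apath u p v \<longleftrightarrow> awalk u p v"
proof
  assume p: "awalk u p v"
  have "distinct (awalk_verts u p)"
  proof (rule ccontr)
    assume "\<not> distinct (awalk_verts u p)"
    from awalk_not_distinct_decomp[OF p this] obtain r w where "r \<noteq> []" "awalk w r w" by auto
    then have "(w, w) \<in> (arcs_ends D)\<^sup>+" using reachable1_awalkI by blast
    then show False using acyclic by (simp add: acyclic_def)
  qed
  then show "apath u p v" using p by (simp add: apath_def)
qed (simp add: apath_def)

text \<open>The cut is made before the arc leaving \<open>x\<close>. If \<open>x\<close> is the last
  vertex of the walk, no arc of it leaves \<open>x\<close>, and the whole walk is kept.\<close>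

definition walk_until :: "'b awalk \<Rightarrow> 'a \<Rightarrow> 'b awalk" where
  "walk_until p x = takeWhile (\<lambda>e. tail D e \<noteq> x) p"

definition walk_from :: "'b awalk \<Rightarrow> 'a \<Rightarrow> 'b awalk" where
  "walk_from p x = dropWhile (\<lambda>e. tail D e \<noteq> x) p"

lemma walk_until_from_append [simp]: "walk_until p x @ walk_from p x = p"
  by (simp add: walk_until_def walk_from_def)

text \<open>Vertices do not repeat, so \<open>x\<close> occurs on \<open>q\<close> only at its end
  and the cut falls exactly between \<open>q\<close> and \<open>r\<close>. Being able to recover the
  pieces is what makes tail swapping undo itself.\<close>

lemma walk_split_append:
  assumes "awalk u q x" "awalk x r v"
  shows "walk_until (q @ r) x = q" "walk_from (q @ r) x = r"
proof -
  have q: "\<forall>e\<in>set q. tail D e \<noteq> x"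
  proof (cases "q = []")
    case False
    have "distinct (awalk_verts u q)" using assms(1) apath_iff_awalk[of u q x] by (simp add: apath_def)
    moreover have "head D (last q) = x"
      using awlast_of_awalk[OF assms(1)] False by (simp add: awalk_verts_conv NOMATCH_def)
    ultimately show ?thesis using False by (auto simp: awalk_verts_conv image_iff)
  qed simp
  have r: "r = [] \<or> tail D (hd r) = x"
    using assms(2) by (cases r) (auto simp: awalk_Cons_iff)
  show "walk_until (q @ r) x = q" "walk_from (q @ r) x = r"
    using q r by (cases r; simp add: walk_until_def walk_from_def takeWhile_append2 dropWhile_append2)+
qed

lemma awalk_until_from:
  assumes "awalk u p v" "x \<in> set (awalk_verts u p)"
  shows "awalk u (walk_until p x) x" "awalk x (walk_from p x) v"
proof -
  obtain q r where "p = q @ r" "awalk u q x" "awalk x r v" using awalk_decomp[OF assms] by blast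
  then show "awalk u (walk_until p x) x" "awalk x (walk_from p x) v"
    using walk_split_append by metis+
qed

lemma mset_awalk_verts_append:
  assumes "awalk u q x" "awalk x r v"
  shows "mset (awalk_verts u (q @ r)) = mset (awalk_verts u q) + mset (tl (awalk_verts x r))"
  using assms awalk_verts_append[of u q r v] by simp

section \<open>Vertex multisets and the exchange of tails\<close>

definition family_verts :: "('i \<Rightarrow> 'a) \<Rightarrow> 'i set \<Rightarrow> ('i \<Rightarrow> 'b awalk) \<Rightarrow> 'a multiset" where
  "family_verts s B \<pi> = (\<Sum>i\<in>B. mset (awalk_verts (s i) (\<pi> i)))"

definition through :: "('i \<Rightarrow> 'a) \<Rightarrow> 'i set \<Rightarrow> ('i \<Rightarrow> 'b awalk) \<Rightarrow> 'a \<Rightarrow> 'i set" where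
  "through s B \<pi> x = {i\<in>B. x \<in> set (awalk_verts (s i) (\<pi> i))}"

definition disjoint_family_on_walks :: "('i \<Rightarrow> 'a) \<Rightarrow> 'i set \<Rightarrow> ('i \<Rightarrow> 'b awalk) \<Rightarrow> bool" where
  "disjoint_family_on_walks s B \<pi> \<longleftrightarrow> (\<forall>i\<in>B. \<forall>j\<in>B. i \<noteq> j \<longrightarrow>
     set (awalk_verts (s i) (\<pi> i)) \<inter> set (awalk_verts (s j) (\<pi> j)) = {})"

definition swap_tails :: "'a \<Rightarrow> 'i \<Rightarrow> 'i \<Rightarrow> ('i \<Rightarrow> 'b awalk) \<Rightarrow> 'i \<Rightarrow> 'b awalk" where
  "swap_tails x i j \<pi> =
     \<pi>(i := walk_until (\<pi> i) x @ walk_from (\<pi> j) x, j := walk_until (\<pi> j) x @ walk_from (\<pi> i) x)"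

text \<open>A walk visits each vertex at most once, so multiplicities count paths.\<close>

lemma count_family_verts:
  assumes "finite B" "\<forall>i\<in>B. awalk (s i) (\<pi> i) (t i)"
  shows "count (family_verts s B \<pi>) x = card (through s B \<pi> x)"
proof -
  have "count (mset (awalk_verts (s i) (\<pi> i))) x = of_bool (x \<in> set (awalk_verts (s i) (\<pi> i)))"
    if "i \<in> B" for i
    using bspec[OF assms(2) that] apath_iff_awalk[of "s i" "\<pi> i" "t i"]
    by (auto simp: apath_def distinct_count_atmost_1)
  moreover have "through s B \<pi> x = B \<inter> {i. x \<in> set (awalk_verts (s i) (\<pi> i))}"
    by (auto simp: through_def)
  ultimately show ?thesis
    using assms(1) by (simp add: family_verts_def count_sum)
qed

text \<open>Shows that being nonintersecting depends on the vertex multiset alone, which tail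
  swapping preserves.\<close>

lemma disjoint_family_iff_count:
  assumes "finite B" "\<forall>i\<in>B. awalk (s i) (\<pi> i) (t i)"
  shows "disjoint_family_on_walks s B \<pi> \<longleftrightarrow> (\<forall>x. count (family_verts s B \<pi>) x \<le> 1)"
proof -
  have fin: "finite (through s B \<pi> x)" for x using assms(1) by (simp add: through_def)
  have "disjoint_family_on_walks s B \<pi> \<longleftrightarrow>
    (\<forall>x. \<forall>i\<in>through s B \<pi> x. \<forall>j\<in>through s B \<pi> x. i = j)"
    unfolding disjoint_family_on_walks_def through_def by blast
  also have "\<dots> \<longleftrightarrow> (\<forall>x. card (through s B \<pi> x) \<le> 1)"
    using fin by (simp add: card_le_Suc0_iff_eq)
  also have "\<dots> \<longleftrightarrow> (\<forall>x. count (family_verts s B \<pi>) x \<le> 1)"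
    using count_family_verts[OF assms] by simp
  finally show ?thesis .
qed

context
  fixes s t :: "'i \<Rightarrow> 'a" and B :: "'i set" and \<pi> :: "'i \<Rightarrow> 'b awalk" and i j :: 'i and x :: 'a
  assumes fin: "finite B"
    and walks: "\<forall>k\<in>B. awalk (s k) (\<pi> k) (t k)"
    and ij: "i \<in> through s B \<pi> x" "j \<in> through s B \<pi> x" "i \<noteq> j"
begin

lemma swap_tails_pieces:
  "i \<in> B" "j \<in> B"
  "awalk (s i) (walk_until (\<pi> i) x) x" "awalk x (walk_from (\<pi> i) x) (t i)"
  "awalk (s j) (walk_until (\<pi> j) x) x" "awalk x (walk_from (\<pi> j) x) (t j)"
proof -
  show B: "i \<in> B" "j \<in> B" using ij by (auto simp: through_def)
  have "x \<in> set (awalk_verts (s i) (\<pi> i))" "x \<in> set (awalk_verts (s j) (\<pi> j))"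
    using ij by (auto simp: through_def)
  with bspec[OF walks B(1)] bspec[OF walks B(2)]
  show "awalk (s i) (walk_until (\<pi> i) x) x" "awalk x (walk_from (\<pi> i) x) (t i)"
    "awalk (s j) (walk_until (\<pi> j) x) x" "awalk x (walk_from (\<pi> j) x) (t j)"
    by (auto intro: awalk_until_from)
qed

lemma swap_tails_at:
  "swap_tails x i j \<pi> i = walk_until (\<pi> i) x @ walk_from (\<pi> j) x"
  "swap_tails x i j \<pi> j = walk_until (\<pi> j) x @ walk_from (\<pi> i) x"
  "k \<noteq> i \<Longrightarrow> k \<noteq> j \<Longrightarrow> swap_tails x i j \<pi> k = \<pi> k"
  using ij by (auto simp: swap_tails_def)

lemma awalk_swap_tails:
  assumes "k \<in> B"
  shows "awalk (s k) (swap_tails x i j \<pi> k) (t (Transposition.transpose i j k))"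
proof -
  consider "k = i" | "k = j" | "k \<noteq> i" "k \<noteq> j" by blast
  then show ?thesis
  proof cases
    case 1
    then show ?thesis
      using awalk_appendI[OF swap_tails_pieces(3) swap_tails_pieces(6)]
      by (simp add: swap_tails_at(1) del: awalk_append_iff)
  next
    case 2
    then show ?thesis
      using awalk_appendI[OF swap_tails_pieces(5) swap_tails_pieces(4)]
      by (simp add: swap_tails_at(2) del: awalk_append_iff)
  next
    case 3
    then show ?thesis using bspec[OF walks assms] by (simp add: swap_tails_at(3))
  qed
qed

lemma swap_tails_swap_tails: "swap_tails x i j (swap_tails x i j \<pi>) = \<pi>"
proof
  fix k
  note split = walk_split_append[OF swap_tails_pieces(3) swap_tails_pieces(6)]
    walk_split_append[OF swap_tails_pieces(5) swap_tails_pieces(4)]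
  show "swap_tails x i j (swap_tails x i j \<pi>) k = \<pi> k"
    using ij(3) by (simp add: swap_tails_def split)
qed

text \<open>The four pieces at \<open>x\<close> are only paired differently, and each of the two
  walks still counts \<open>x\<close> once.\<close>

lemma family_verts_swap_tails: "family_verts s B (swap_tails x i j \<pi>) = family_verts s B \<pi>"
proof -
  let ?m = "\<lambda>\<pi> k. mset (awalk_verts (s k) (\<pi> k))"
  have split: "family_verts s B \<rho> = ?m \<rho> i + ?m \<rho> j + (\<Sum>k\<in>B - {i} - {j}. ?m \<rho> k)" for \<rho>
    using fin swap_tails_pieces(1,2) ij(3) sum.remove[of B i "?m \<rho>"] sum.remove[of "B - {i}" j "?m \<rho>"]
    by (simp add: family_verts_def ac_simps)
  have rest: "(\<Sum>k\<in>B - {i} - {j}. ?m (swap_tails x i j \<pi>) k) = (\<Sum>k\<in>B - {i} - {j}. ?m \<pi> k)"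
    by (intro sum.cong) (auto simp: swap_tails_at)
  have "?m (swap_tails x i j \<pi>) i = mset (awalk_verts (s i) (walk_until (\<pi> i) x)) + mset (tl (awalk_verts x (walk_from (\<pi> j) x)))"
    "?m (swap_tails x i j \<pi>) j = mset (awalk_verts (s j) (walk_until (\<pi> j) x)) + mset (tl (awalk_verts x (walk_from (\<pi> i) x)))"
    unfolding swap_tails_at
    by (rule mset_awalk_verts_append[OF swap_tails_pieces(3,6)] mset_awalk_verts_append[OF swap_tails_pieces(5,4)])+
  moreover have "?m \<pi> i = mset (awalk_verts (s i) (walk_until (\<pi> i) x)) + mset (tl (awalk_verts x (walk_from (\<pi> i) x)))"
    "?m \<pi> j = mset (awalk_verts (s j) (walk_until (\<pi> j) x)) + mset (tl (awalk_verts x (walk_from (\<pi> j) x)))"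
    using mset_awalk_verts_append[OF swap_tails_pieces(3,4)] mset_awalk_verts_append[OF swap_tails_pieces(5,6)]
    by simp_all
  ultimately show ?thesis unfolding split rest by (simp add: ac_simps)
qed

text \<open>Both new walks still pass through \<open>x\<close>. A pair chosen from this set is
  therefore chosen again after the swap.\<close>

lemma through_swap_tails: "through s B (swap_tails x i j \<pi>) x = through s B \<pi> x"
proof -
  have "x \<in> set (awalk_verts (s i) (swap_tails x i j \<pi> i))"
    "x \<in> set (awalk_verts (s j) (swap_tails x i j \<pi> j))"
    unfolding swap_tails_at set_awalk_verts_append[OF swap_tails_pieces(3,6)]
      set_awalk_verts_append[OF swap_tails_pieces(5,4)]
    using hd_in_awalk_verts(1)[OF swap_tails_pieces(4)] hd_in_awalk_verts(1)[OF swap_tails_pieces(6)]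
    by simp_all
  then have "k \<in> through s B (swap_tails x i j \<pi>) x \<longleftrightarrow> k \<in> through s B \<pi> x" for k
    using ij swap_tails_at(3)[of k] unfolding through_def by (cases "k = i"; cases "k = j") simp_all
  then show ?thesis by blast
qed

lemma path_weight_swap_tails:
  "(\<Prod>k\<in>B. path_weight wt (swap_tails x i j \<pi> k)) = (\<Prod>k\<in>B. path_weight wt (\<pi> k))"
proof -
  let ?m = "\<lambda>\<pi> k. path_weight wt (\<pi> k)"
  have split: "(\<Prod>k\<in>B. ?m \<rho> k) = ?m \<rho> i * ?m \<rho> j * (\<Prod>k\<in>B - {i} - {j}. ?m \<rho> k)" for \<rho>
    using fin swap_tails_pieces(1,2) ij(3) prod.remove[of B i "?m \<rho>"] prod.remove[of "B - {i}" j "?m \<rho>"]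
    by (simp add: ac_simps)
  have rest: "(\<Prod>k\<in>B - {i} - {j}. ?m (swap_tails x i j \<pi>) k) = (\<Prod>k\<in>B - {i} - {j}. ?m \<pi> k)"
    by (intro prod.cong) (auto simp: swap_tails_at)
  have app: "path_weight wt (p @ q) = path_weight wt p * path_weight wt q" for p q
    by (simp add: path_weight_def)
  have "?m (swap_tails x i j \<pi>) i * ?m (swap_tails x i j \<pi>) j =
     ?m (\<lambda>_. walk_until (\<pi> i) x @ walk_from (\<pi> i) x) i * ?m (\<lambda>_. walk_until (\<pi> j) x @ walk_from (\<pi> j) x) j"
    unfolding swap_tails_at app by (simp add: ac_simps)
  then show ?thesis unfolding split rest by simp
qed

end

text \<open>The vertex multiset of a family does not change under the swap, so neither does any choice
  made from it; this makes tail swapping an involution.\<close>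

lemma lindstrom_gessel_viennot:
  fixes s t :: "'i \<Rightarrow> 'a" and wt :: "'b \<Rightarrow> real"
  assumes fin: "finite B"
  shows "det_on B (\<lambda>i j. \<Sum>p | apath (s i) p (t j). path_weight wt p) =
    (\<Sum>(w, \<pi>) \<in> {(w, \<pi>). w permutes B \<and> \<pi> \<in> (\<Pi>\<^sub>E i\<in>B. {p. apath (s i) p (t (w i))}) \<and>
       disjoint_family_on_walks s B \<pi>}. of_int (sign w) * (\<Prod>i\<in>B. path_weight wt (\<pi> i)))"
proof -
  define F where "F w = (\<Pi>\<^sub>E i\<in>B. {p. apath (s i) p (t (w i))})" for w
  let ?f = "\<lambda>(w, \<pi>). of_int (sign w) * (\<Prod>i\<in>B. path_weight wt (\<pi> i))"
  define S where "S = Sigma {w. w permutes B} F"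
  define N where "N = {(w, \<pi>). w permutes B \<and> \<pi> \<in> F w \<and> disjoint_family_on_walks s B \<pi>}"
  have finF: "finite (F w)" for w unfolding F_def using fin by (intro finite_PiE apaths_finite)
  have finS: "finite S" unfolding S_def using fin finF by (simp add: finite_permutations)
  have NS: "N \<subseteq> S" by (auto simp: N_def S_def)
  \<comment> \<open>Multiplying out the sums over paths gives a sum over all families of type
    \<open>w\<close>.\<close>
  have "det_on B (\<lambda>i j. \<Sum>p | apath (s i) p (t j). path_weight wt p) =
      (\<Sum>w | w permutes B. \<Sum>\<pi>\<in>F w. ?f (w, \<pi>))"
    unfolding det_on_def F_def using fin
    by (simp add: prod_sum_PiE apaths_finite sum_distrib_left)
  also have "\<dots> = sum ?f S"
    unfolding S_def using finF by (subst sum.Sigma) (simp_all add: finite_permutations[OF fin])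
  also have "\<dots> = sum ?f N + sum ?f (S - N)"
    using sum.subset_diff[OF NS finS, of ?f] by (simp only: add.commute)
  also have "sum ?f (S - N) = 0"
  proof -
    define pt where "pt \<pi> = (SOME x. 2 \<le> count (family_verts s B \<pi>) x)" for \<pi>
    \<comment> \<open>The ordered pair depends only on the set of paths through the chosen vertex,
      so a second swap uses the same vertex and the same pair as the first.\<close>
    define pr where "pr \<pi> = (SOME (i, j). i \<in> through s B \<pi> (pt \<pi>) \<and> j \<in> through s B \<pi> (pt \<pi>) \<and> i \<noteq> j)" for \<pi>
    have pt_cong: "pt \<rho> = pt \<pi>" if "family_verts s B \<rho> = family_verts s B \<pi>" for \<rho> \<pi>
      by (simp only: pt_def that)
    have pr_cong: "pr \<rho> = pr \<pi>"
      if "pt \<rho> = pt \<pi>" "through s B \<rho> (pt \<pi>) = through s B \<pi> (pt \<pi>)" for \<rho> \<pi>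
      by (simp only: pr_def that)
    let ?i = "\<lambda>\<pi>. fst (pr \<pi>)" and ?j = "\<lambda>\<pi>. snd (pr \<pi>)"
    let ?swap = "\<lambda>\<pi>. swap_tails (pt \<pi>) (?i \<pi>) (?j \<pi>) \<pi>"
    let ?h = "\<lambda>(w, \<pi>). (w \<circ> Transposition.transpose (?i \<pi>) (?j \<pi>), ?swap \<pi>)"
    have key: "?h z \<in> S - N \<and> ?h (?h z) = z \<and> ?f (?h z) = - ?f z" if z: "z \<in> S - N" for z
    proof -
      obtain w \<pi> where z_eq: "z = (w, \<pi>)" by (cases z)
      have w: "w permutes B" and \<pi>: "\<pi> \<in> F w" and meet: "\<not> disjoint_family_on_walks s B \<pi>"
        using z by (auto simp: z_eq S_def N_def)
      have walks: "\<forall>k\<in>B. awalk (s k) (\<pi> k) (t (w k))"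
        using \<pi> by (auto simp: F_def apath_iff_awalk PiE_def Pi_def)
      note disj = disjoint_family_iff_count[where s = s and t = "\<lambda>k. t (w k)" and \<pi> = \<pi>, OF fin walks]
      obtain x where "\<not> count (family_verts s B \<pi>) x \<le> 1" using meet disj by blast
      then have "2 \<le> count (family_verts s B \<pi>) x" by simp
      then have "\<exists>x. 2 \<le> count (family_verts s B \<pi>) x" by blast
      then have "2 \<le> count (family_verts s B \<pi>) (pt \<pi>)" unfolding pt_def by (rule someI_ex)
      then have "\<not> card (through s B \<pi> (pt \<pi>)) \<le> Suc 0"
        using count_family_verts[where s = s and t = "\<lambda>k. t (w k)" and \<pi> = \<pi>, OF fin walks] by simp
      moreover have "finite (through s B \<pi> (pt \<pi>))" using fin by (simp add: through_def)
      ultimately obtain i j where "i \<in> through s B \<pi> (pt \<pi>)" "j \<in> through s B \<pi> (pt \<pi>)" "i \<noteq> j"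
        using card_le_Suc0_iff_eq by blast
      then have "\<exists>z. case z of (i, j) \<Rightarrow> i \<in> through s B \<pi> (pt \<pi>) \<and> j \<in> through s B \<pi> (pt \<pi>) \<and> i \<noteq> j"
        by auto
      from someI_ex[OF this] have ij: "?i \<pi> \<in> through s B \<pi> (pt \<pi>)" "?j \<pi> \<in> through s B \<pi> (pt \<pi>)" "?i \<pi> \<noteq> ?j \<pi>"
        unfolding pr_def by (auto simp: case_prod_unfold)
      have pt: "pt (?swap \<pi>) = pt \<pi>"
        by (rule pt_cong, rule family_verts_swap_tails[where s = s and t = "\<lambda>k. t (w k)", OF fin walks ij])
      have pr: "pr (?swap \<pi>) = pr \<pi>"
        by (rule pr_cong[OF pt], rule through_swap_tails[where s = s and t = "\<lambda>k. t (w k)", OF fin walks ij])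
      let ?w = "w \<circ> Transposition.transpose (?i \<pi>) (?j \<pi>)"
      have iB: "?i \<pi> \<in> B" "?j \<pi> \<in> B" using ij by (auto simp: through_def)
      have w': "?w permutes B"
        using w iB by (intro permutes_compose permutes_swap_id)
      have walks': "\<forall>k\<in>B. awalk (s k) (?swap \<pi> k) (t (?w k))"
        using awalk_swap_tails[where s = s and t = "\<lambda>k. t (w k)" and \<pi> = \<pi>, OF fin walks ij] by simp
      have "?swap \<pi> k = undefined" if "k \<notin> B" for k
        using that \<pi> iB by (auto simp: F_def swap_tails_def PiE_def extensional_def)
      then have F': "?swap \<pi> \<in> F ?w"
        using walks' by (auto simp: F_def apath_iff_awalk PiE_def extensional_def)
      have verts: "family_verts s B (?swap \<pi>) = family_verts s B \<pi>"
        by (rule family_verts_swap_tails[where s = s and t = "\<lambda>k. t (w k)", OF fin walks ij])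
      \<comment> \<open>Intersecting families are recognised by their vertex multiset, so the swap
        stays among them.\<close>
      have meet': "\<not> disjoint_family_on_walks s B (?swap \<pi>)"
        using meet by (simp only: disj verts disjoint_family_iff_count
          [where s = s and t = "\<lambda>k. t (?w k)" and \<pi> = "?swap \<pi>", OF fin walks'] not_False_eq_True)
      have hz: "?h z = (?w, ?swap \<pi>)" by (simp only: z_eq prod.case)
      have "(?w, ?swap \<pi>) \<in> S" unfolding S_def using w' F' by blast
      moreover have "(?w, ?swap \<pi>) \<notin> N" unfolding N_def using meet' by blast
      ultimately have 1: "?h z \<in> S - N" unfolding hz by (rule DiffI)
      have 2: "?h (?h z) = z"
        unfolding hz prod.case pt pr swap_tails_swap_tails[where s = s and t = "\<lambda>k. t (w k)" and \<pi> = \<pi>, OF fin walks ij] comp_assoc z_eq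
        by (simp only: transpose_comp_involutory comp_id)
      have "sign ?w = - sign w"
        using ij(3) sign_compose[OF permutes_imp_permutation[OF fin w] permutation_swap_id]
        by (simp add: sign_swap_id)
      then have 3: "?f (?h z) = - ?f z"
        unfolding hz z_eq prod.case path_weight_swap_tails[where s = s and t = "\<lambda>k. t (w k)" and \<pi> = \<pi>, OF fin walks ij]
        by (simp only: of_int_minus mult_minus_left)
      show ?thesis using 1 2 3 by (intro conjI)
    qed
    show ?thesis
      by (rule sum_sign_reversing[of "S - N" ?h ?f])
        (erule key[THEN conjunct1] key[THEN conjunct2, THEN conjunct1] key[THEN conjunct2, THEN conjunct2])+
  qed
  finally show ?thesis unfolding N_def F_def by simp
qed

end

section \<open>Planar networks\<close>

lemma disc_embedding_arcs:
  assumes "disc_embedding D n s t \<phi> \<gamma>" "e \<in> arcs D"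
  shows "path (\<gamma> e)" "path_image (\<gamma> e) \<subseteq> cball 0 1"
    "pathstart (\<gamma> e) = \<phi> (tail D e)" "pathfinish (\<gamma> e) = \<phi> (head D e)"
  using assms by (simp_all add: disc_embedding_def arc_imp_path)

lemma disc_embedding_arcs_meet:
  assumes "disc_embedding D n s t \<phi> \<gamma>" "e \<in> arcs D" "f \<in> arcs D" "e \<noteq> f"
  shows "path_image (\<gamma> e) \<inter> path_image (\<gamma> f) \<subseteq> \<phi> ` ({tail D e, head D e} \<inter> {tail D f, head D f})"
proof -
  have "\<forall>e\<in>arcs D. \<forall>f\<in>arcs D. e \<noteq> f \<longrightarrow> path_image (\<gamma> e) \<inter> path_image (\<gamma> f)
      \<subseteq> \<phi> ` ({tail D e, head D e} \<inter> {tail D f, head D f})"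
    using assms(1) unfolding disc_embedding_def by (elim conjE)
  then show ?thesis using assms(2-4) by blast
qed

lemma disc_embedding_angles:
  assumes "disc_embedding D n s t \<phi> \<gamma>"
  obtains \<theta> :: "nat \<Rightarrow> real" where
    "\<forall>k\<in>{1..2*n}. \<phi> (boundary_vertex n s t k) = cis (\<theta> k)"
    "\<forall>k\<in>{1..2*n}. \<forall>l\<in>{1..2*n}. k < l \<longrightarrow> \<theta> l < \<theta> k \<and> \<theta> k < \<theta> l + 2 * pi"
  using assms unfolding disc_embedding_def by (elim conjE exE)

context planar_network
begin

sublocale acyclic_digraph D
  by unfold_locales (rule acyclic_edges)

text \<open>The drawings of the arcs are joined one after the other. An empty walk has no arc whose
  drawing could contain \<open>\<phi> u\<close>, hence the condition on \<open>p\<close>.\<close>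

lemma walk_drawing:
  assumes emb: "disc_embedding D n s t \<phi> \<gamma>"
    and "awalk u p v" "p \<noteq> []"
  shows "\<exists>g. path g \<and> pathstart g = \<phi> u \<and> pathfinish g = \<phi> v \<and>
    path_image g \<subseteq> (\<Union>e\<in>set p. path_image (\<gamma> e))"
  using assms(2,3)
proof (induction p arbitrary: u)
  case (Cons e p)
  have e: "e \<in> arcs D" "tail D e = u" and p: "awalk (head D e) p v"
    using Cons.prems by (auto simp: awalk_Cons_iff)
  have \<gamma>: "path (\<gamma> e)" "pathstart (\<gamma> e) = \<phi> u" "pathfinish (\<gamma> e) = \<phi> (head D e)"
    using disc_embedding_arcs[OF emb e(1)] e(2) by simp_all
  show ?case
  proof (cases "p = []")
    case True
    then show ?thesis using \<gamma> p by (intro exI[of _ "\<gamma> e"]) (auto simp: awalk_Nil_iff)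
  next
    case False
    from Cons.IH[OF p this] obtain g where g: "path g" "pathstart g = \<phi> (head D e)"
      "pathfinish g = \<phi> v" "path_image g \<subseteq> (\<Union>e\<in>set p. path_image (\<gamma> e))" by blast
    have "path_image (\<gamma> e +++ g) \<subseteq> (\<Union>e\<in>set (e # p). path_image (\<gamma> e))"
      using g(4) path_image_join_subset[of "\<gamma> e" g] by auto
    then show ?thesis using \<gamma> g by (intro exI[of _ "\<gamma> e +++ g"]) simp
  qed
qed simp

lemma boundary_vertices_distinct:
  assumes "k \<in> {1..2*n}" "l \<in> {1..2*n}" "k < l"
  shows "boundary_vertex n s t k \<noteq> boundary_vertex n s t l"
proof
  assume eq: "boundary_vertex n s t k = boundary_vertex n s t l"
  obtain \<phi> \<gamma> where emb: "disc_embedding D n s t \<phi> \<gamma>" using embeddable by blast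
  obtain \<theta> :: "nat \<Rightarrow> real" where
    "\<forall>k\<in>{1..2*n}. \<phi> (boundary_vertex n s t k) = cis (\<theta> k)"
    "\<forall>k\<in>{1..2*n}. \<forall>l\<in>{1..2*n}. k < l \<longrightarrow> \<theta> l < \<theta> k \<and> \<theta> k < \<theta> l + 2 * pi"
    by (rule disc_embedding_angles[OF emb])
  then have \<theta>: "cis (\<theta> k) = cis (\<theta> l)" "\<theta> l < \<theta> k" "\<theta> k < \<theta> l + 2 * pi"
    using assms eq by metis+
  then have "cis (\<theta> k - \<theta> l) = 1" by (simp flip: cis_divide)
  then have "\<theta> k - \<theta> l = 0" using \<theta> by (intro cis_eq_1_imp_0) auto
  then show False using \<theta> by simp
qed

lemma boundary_vertex_source: "k \<in> {1..n} \<Longrightarrow> boundary_vertex n s t k = s k"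
  by (simp add: boundary_vertex_def)

lemma boundary_vertex_sink:
  assumes "k \<in> {1..n}"
  shows "boundary_vertex n s t (2 * n + 1 - k) = t k"
proof -
  have "2 * n + 1 - (2 * n + 1 - k) = k" "\<not> 2 * n + 1 - k \<le> n" using assms by auto
  then show ?thesis by (simp add: boundary_vertex_def)
qed

lemma source_neq_sink:
  assumes "i \<in> {1..n}" "k \<in> {1..n}"
  shows "s i \<noteq> t k"
proof -
  have "i \<in> {1..2*n}" "2 * n + 1 - k \<in> {1..2*n}" "i < 2 * n + 1 - k" using assms by auto
  from boundary_vertices_distinct[OF this] show ?thesis
    unfolding boundary_vertex_source[OF assms(1)] boundary_vertex_sink[OF assms(2)] .
qed

lemma sources_inj: "inj_on s {1..n}"
proof (rule linorder_inj_onI)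
  fix i j assume "i < j" "i \<in> {1..n}" "j \<in> {1..n}"
  then show "s i \<noteq> s j"
    using boundary_vertices_distinct[of i j] by (simp add: boundary_vertex_source)
qed auto

lemma awalk_source_sink_nonempty:
  assumes "awalk (s i) p (t k)" "i \<in> {1..n}" "k \<in> {1..n}"
  shows "p \<noteq> []"
  using assms source_neq_sink by (auto simp: awalk_Nil_iff)

text \<open>Clockwise, the four ends come in the order \<open>s i\<close>, \<open>s j\<close>,
  \<open>t k\<close>, \<open>t l\<close>, so the two drawings are interlacing chords and meet. In an
  embedding they can meet only where the walks share an arc or a vertex.\<close>

lemma crossing_walks_meet:
  assumes ij: "i \<in> {1..n}" "j \<in> {1..n}" "i < j" and kl: "k \<in> {1..n}" "l \<in> {1..n}" "l < k"
    and p: "awalk (s i) p (t k)" and q: "awalk (s j) q (t l)"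
  shows "set (awalk_verts (s i) p) \<inter> set (awalk_verts (s j) q) \<noteq> {}"
proof -
  obtain \<phi> \<gamma> where emb: "disc_embedding D n s t \<phi> \<gamma>" using embeddable by blast
  obtain \<theta> :: "nat \<Rightarrow> real" where
    cis: "\<forall>k\<in>{1..2*n}. \<phi> (boundary_vertex n s t k) = cis (\<theta> k)" and
    ord: "\<forall>k\<in>{1..2*n}. \<forall>l\<in>{1..2*n}. k < l \<longrightarrow> \<theta> l < \<theta> k \<and> \<theta> k < \<theta> l + 2 * pi"
    by (rule disc_embedding_angles[OF emb])
  have p_arcs: "set p \<subseteq> arcs D" and q_arcs: "set q \<subseteq> arcs D" using p q by (auto simp: awalk_def)
  have ball: "path_image (\<gamma> e) \<subseteq> cball 0 1" if "e \<in> arcs D" for e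
    using disc_embedding_arcs(2)[OF emb that] .
  obtain f where f: "path f" "pathstart f = \<phi> (s i)" "pathfinish f = \<phi> (t k)"
    "path_image f \<subseteq> (\<Union>e\<in>set p. path_image (\<gamma> e))"
    using walk_drawing[OF emb p awalk_source_sink_nonempty[OF p ij(1) kl(1)]] by blast
  obtain g where g: "path g" "pathstart g = \<phi> (s j)" "pathfinish g = \<phi> (t l)"
    "path_image g \<subseteq> (\<Union>e\<in>set q. path_image (\<gamma> e))"
    using walk_drawing[OF emb q awalk_source_sink_nonempty[OF q ij(2) kl(2)]] by blast
  let ?k = "2 * n + 1 - k" and ?l = "2 * n + 1 - l"
  have pos: "i \<in> {1..2*n}" "j \<in> {1..2*n}" "?k \<in> {1..2*n}" "?l \<in> {1..2*n}" "j < ?k" "?k < ?l" "i < ?l"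
    using ij kl by auto
  have s_cis: "\<phi> (s m) = cis (\<theta> m)" if "m \<in> {1..n}" for m
    using bspec[OF cis, of m] that by (simp add: boundary_vertex_source)
  have t_cis: "\<phi> (t m) = cis (\<theta> (2 * n + 1 - m))" if "m \<in> {1..n}" for m
  proof -
    have "2 * n + 1 - m \<in> {1..2*n}" using that by auto
    from bspec[OF cis this] show ?thesis unfolding boundary_vertex_sink[OF that] .
  qed
  have "path_image f \<inter> path_image g \<noteq> {}"
  proof (rule chords_cross)
    show "path_image f \<subseteq> cball 0 1" using f(4) p_arcs ball by blast
    show "path_image g \<subseteq> cball 0 1" using g(4) q_arcs ball by blast
    show "pathstart f = cis (\<theta> i)" "pathfinish f = cis (\<theta> ?k)"
      "pathstart g = cis (\<theta> j)" "pathfinish g = cis (\<theta> ?l)"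
      using f g s_cis t_cis ij kl by simp_all
    \<comment> \<open>Clockwise positions carry decreasing angles, so the later sink position
      \<open>?l\<close> has the smallest angle.\<close>
    show "\<theta> ?l < \<theta> ?k" "\<theta> ?k < \<theta> j" "\<theta> j < \<theta> i" "\<theta> i < \<theta> ?l + 2 * pi"
      using bspec[OF bspec[OF ord pos(3)] pos(4)] bspec[OF bspec[OF ord pos(2)] pos(3)]
        bspec[OF bspec[OF ord pos(1)] pos(2)] bspec[OF bspec[OF ord pos(1)] pos(4)] pos(5-7) ij(3) by simp_all
  qed (use f g in auto)
  then obtain z e e' where z: "e \<in> set p" "e' \<in> set q" "z \<in> path_image (\<gamma> e)" "z \<in> path_image (\<gamma> e')"
    using f(4) g(4) by blast
  \<comment> \<open>For a shared arc either end will do; distinct arcs are drawn so as to meet only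
    at common ends.\<close>
  have "\<exists>v. v \<in> {tail D e, head D e} \<inter> {tail D e', head D e'}"
  proof (cases "e = e'")
    case False
    have "e \<in> arcs D" "e' \<in> arcs D" using z p_arcs q_arcs by auto
    then have "path_image (\<gamma> e) \<inter> path_image (\<gamma> e')
        \<subseteq> \<phi> ` ({tail D e, head D e} \<inter> {tail D e', head D e'})"
      using False by (rule disc_embedding_arcs_meet[OF emb])
    then show ?thesis using z by blast
  qed auto
  then obtain v where v: "v \<in> {tail D e, head D e}" "v \<in> {tail D e', head D e'}" by blast
  have "v \<in> set (awalk_verts (s i) p)" "v \<in> set (awalk_verts (s j) q)"
    using v awalk_verts_arc1[OF z(1), of "s i"] awalk_verts_arc2[OF p z(1)]
      awalk_verts_arc1[OF z(2), of "s j"] awalk_verts_arc2[OF q z(2)] by auto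
  then show ?thesis by blast
qed

section \<open>The order on a family of identity type\<close>

abbreviation straight_paths :: "nat \<Rightarrow> 'b awalk set" where
  "straight_paths i \<equiv> {p. apath (s i) p (t i)}"

text \<open>The order of \<open>P(\<pi>)\<close> transported to indices, so that it can serve as the
  pattern of a 0/1 matrix.\<close>

definition path_less :: "(nat \<Rightarrow> 'b awalk) \<Rightarrow> nat \<Rightarrow> nat \<Rightarrow> bool" where
  "path_less \<pi> i j \<longleftrightarrow> i < j \<and>
     set (awalk_verts (s i) (\<pi> i)) \<inter> set (awalk_verts (s j) (\<pi> j)) = {}"

text \<open>If \<open>\<pi> i\<close> met \<open>\<pi> k\<close>, one could go from \<open>s i\<close> to \<open>t k\<close> without meeting \<open>\<pi> j\<close>.\<close>

lemma path_less_trans: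
  assumes mem: "i \<in> {1..n}" "j \<in> {1..n}" "k \<in> {1..n}"
    and \<pi>: "\<pi> i \<in> straight_paths i" "\<pi> j \<in> straight_paths j" "\<pi> k \<in> straight_paths k"
    and less: "path_less \<pi> i j" "path_less \<pi> j k"
  shows "path_less \<pi> i k"
proof (rule ccontr)
  assume "\<not> path_less \<pi> i k"
  then obtain x where x: "x \<in> set (awalk_verts (s i) (\<pi> i))" "x \<in> set (awalk_verts (s k) (\<pi> k))"
    using less unfolding path_less_def by fastforce
  obtain q r where q: "\<pi> i = q @ r" "awalk (s i) q x" "awalk x r (t i)"
    using awalk_decomp[of "s i" "\<pi> i" "t i" x] x(1) \<pi>(1) unfolding mem_Collect_eq apath_iff_awalk by blast
  obtain q' r' where q': "\<pi> k = q' @ r'" "awalk (s k) q' x" "awalk x r' (t k)"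
    using awalk_decomp[of "s k" "\<pi> k" "t k" x] x(2) \<pi>(3) unfolding mem_Collect_eq apath_iff_awalk by blast
  \<comment> \<open>This walk starts before \<open>s j\<close> and ends beyond \<open>t j\<close>,
    so it must cross \<open>\<pi> j\<close>, although its vertices all lie on \<open>\<pi> i\<close>
    or \<open>\<pi> k\<close>.\<close>
  have "awalk (s i) (q @ r') (t k)" using q(2) q'(3) by (rule awalk_appendI)
  then have "set (awalk_verts (s i) (q @ r')) \<inter> set (awalk_verts (s j) (\<pi> j)) \<noteq> {}"
    using mem \<pi>(2) less by (intro crossing_walks_meet[of i j k j]) (auto simp: apath_iff_awalk path_less_def)
  moreover have "set (awalk_verts (s i) (q @ r')) \<subseteq>
      set (awalk_verts (s i) (\<pi> i)) \<union> set (awalk_verts (s k) (\<pi> k))"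
    unfolding q(1) q'(1) set_awalk_verts_append[OF q(2) q'(3)] set_awalk_verts_append[OF q(2,3)]
      set_awalk_verts_append[OF q'(2,3)] by blast
  ultimately show False using less unfolding path_less_def by blast
qed

section \<open>Minors and permanents of the two matrices\<close>

lemma det_on_path_matrix:
  assumes B: "B \<subseteq> {1..n}"
  shows "det_on B (path_matrix D s t wt) =
    (\<Sum>\<pi>\<in>Pi\<^sub>E B straight_paths. of_bool (disjoint_family_on_walks s B \<pi>) * (\<Prod>i\<in>B. path_weight wt (\<pi> i)))"
proof -
  have fin: "finite B" using B finite_subset by blast
  let ?N = "{\<pi> \<in> Pi\<^sub>E B straight_paths. disjoint_family_on_walks s B \<pi>}"
  \<comment> \<open>A type other than the identity has an inversion, and the two paths at it cross.
    So only the identity, with sign 1, is left in the sum over nonintersecting families.\<close>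
  have id: "w = id" if w: "w permutes B" and \<pi>: "\<pi> \<in> (\<Pi>\<^sub>E i\<in>B. {p. apath (s i) p (t (w i))})"
    and disj: "disjoint_family_on_walks s B \<pi>" for w \<pi>
  proof (rule ccontr)
    assume "w \<noteq> id"
    with w obtain i j where ij: "i \<in> B" "j \<in> B" "i < j" "w j < w i" by (rule permutes_inversion)
    have "awalk (s i) (\<pi> i) (t (w i))" "awalk (s j) (\<pi> j) (t (w j))"
      using \<pi> ij by (auto simp: apath_iff_awalk PiE_def Pi_def)
    moreover have "w i \<in> B" "w j \<in> B" using ij permutes_in_image[OF w] by auto
    ultimately have "set (awalk_verts (s i) (\<pi> i)) \<inter> set (awalk_verts (s j) (\<pi> j)) \<noteq> {}"
      using ij B by (intro crossing_walks_meet[of i j "w i" "w j"]) auto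
    then show False using disj ij unfolding disjoint_family_on_walks_def by auto
  qed
  have "{(w, \<pi>). w permutes B \<and> \<pi> \<in> (\<Pi>\<^sub>E i\<in>B. {p. apath (s i) p (t (w i))}) \<and>
       disjoint_family_on_walks s B \<pi>} = Pair (id :: nat \<Rightarrow> nat) ` ?N" (is "?L = ?R")
  proof (intro subset_antisym subsetI)
    fix z assume z: "z \<in> ?L"
    then obtain w \<pi> where [simp]: "z = (w, \<pi>)" by (cases z)
    have "w = id" using z by (intro id[of w \<pi>]) auto
    then show "z \<in> ?R" using z by auto
  qed (auto simp: permutes_id)
  moreover have "det_on B (path_matrix D s t wt) =
      det_on B (\<lambda>i j. \<Sum>p | apath (s i) p (t j). path_weight wt p)"
    by (simp add: path_matrix_def cong: det_on_cong)
  ultimately have "det_on B (path_matrix D s t wt) =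
      (\<Sum>(w, \<pi>)\<in>Pair (id :: nat \<Rightarrow> nat) ` ?N. of_int (sign w) * (\<Prod>i\<in>B. path_weight wt (\<pi> i)))"
    using lindstrom_gessel_viennot[OF fin, where s = s and t = t and wt = wt] by simp
  also have "\<dots> = (\<Sum>\<pi>\<in>?N. \<Prod>i\<in>B. path_weight wt (\<pi> i))"
    by (subst sum.reindex) (auto simp: inj_on_def)
  also have "\<dots> = (\<Sum>\<pi>\<in>Pi\<^sub>E B straight_paths.
      of_bool (disjoint_family_on_walks s B \<pi>) * (\<Prod>i\<in>B. path_weight wt (\<pi> i)))"
    using fin by (intro sum.mono_neutral_cong_left) (auto intro!: finite_PiE apaths_finite)
  finally show ?thesis .
qed

text \<open>Distinct indices are comparable exactly when their paths are disjoint, so chains are the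
  nonintersecting subfamilies. The indicator in the minors of the path matrix thus becomes a minor
  itself.\<close>

lemma det_on_path_less:
  assumes B: "B \<subseteq> {1..n}" and \<pi>: "\<forall>i\<in>B. \<pi> i \<in> straight_paths i"
  shows "det_on B (\<lambda>i j. of_bool (\<not> path_less \<pi> i j) :: real) =
    of_bool (disjoint_family_on_walks s B \<pi>)"
proof -
  have "det_on B (\<lambda>i j. of_bool (\<not> path_less \<pi> i j) :: real) =
      of_bool (\<forall>i\<in>B. \<forall>j\<in>B. i \<noteq> j \<longrightarrow> path_less \<pi> i j \<or> path_less \<pi> j i)"
  proof (rule det_on_poset_matrix)
    show "finite B" using B finite_subset by blast
    show "\<not> path_less \<pi> i i" for i by (simp add: path_less_def)
    show "path_less \<pi> i k" if "i \<in> B" "j \<in> B" "k \<in> B" "path_less \<pi> i j" "path_less \<pi> j k" for i j k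
      using that \<pi> B by (intro path_less_trans[of i j k]) blast+
  qed
  also have "(\<forall>i\<in>B. \<forall>j\<in>B. i \<noteq> j \<longrightarrow> path_less \<pi> i j \<or> path_less \<pi> j i) \<longleftrightarrow>
      disjoint_family_on_walks s B \<pi>"
    unfolding disjoint_family_on_walks_def path_less_def
    by (metis Int_commute linorder_less_linear)
  finally show ?thesis .
qed

text \<open>By induction on \<open>U\<close>, the recursion is unfolded for the path matrix, its
  terms are written as sums over families, and it is folded up again for the 0/1 matrix of each
  family separately.\<close>

lemma perm_on_path_matrix:
  assumes "U \<subseteq> {1..n}"
  shows "perm_on U (path_matrix D s t wt) =
    (\<Sum>\<pi>\<in>Pi\<^sub>E U straight_paths. (\<Prod>i\<in>U. path_weight wt (\<pi> i)) *
       perm_on U (\<lambda>i j. of_bool (\<not> path_less \<pi> i j)))"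
proof -
  let ?A = "path_matrix D s t wt"
  let ?M = "\<lambda>\<pi> i j. of_bool (\<not> path_less \<pi> i j) :: real"
  let ?W = "\<lambda>B \<pi>. \<Prod>i\<in>B. path_weight wt (\<pi> i)"
  have "finite U" using assms finite_subset by blast
  then show ?thesis using assms
  proof (induction U rule: finite_psubset_induct)
    case (psubset U)
    show ?case
    proof (cases "U = {}")
      case True
      then show ?thesis by (simp add: perm_on_def)
    next
      case False
      let ?S = "Pow U - {{}}"
      have B: "(- 1) ^ card B * det_on B ?A * perm_on (U - B) ?A =
          (\<Sum>\<pi>\<in>Pi\<^sub>E U straight_paths. ?W U \<pi> *
            ((- 1) ^ card B * det_on B (?M \<pi>) * perm_on (U - B) (?M \<pi>)))" if "B \<in> ?S" for B
      proof -
        have BU: "B \<subseteq> U" and "U - B \<subset> U" using that by auto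
        have IH: "perm_on (U - B) ?A =
            (\<Sum>\<pi>\<in>Pi\<^sub>E (U - B) straight_paths. ?W (U - B) \<pi> * perm_on (U - B) (?M \<pi>))"
          using psubset.prems by (intro psubset.IH[OF \<open>U - B \<subset> U\<close>]) auto
        have "det_on B ?A = (\<Sum>\<pi>\<in>Pi\<^sub>E B straight_paths.
            of_bool (disjoint_family_on_walks s B \<pi>) * ?W B \<pi>)"
          using BU psubset.prems by (intro det_on_path_matrix) auto
        \<comment> \<open>The indicator is replaced by the minor on \<open>B\<close> of the 0/1
          matrix of \<open>\<pi>\<close>.\<close>
        also have "\<dots> = (\<Sum>\<pi>\<in>Pi\<^sub>E B straight_paths. det_on B (?M \<pi>) * ?W B \<pi>)"
        proof (rule sum.cong[OF refl])
          fix \<pi> assume "\<pi> \<in> Pi\<^sub>E B straight_paths"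
          then have "det_on B (?M \<pi>) = of_bool (disjoint_family_on_walks s B \<pi>)"
            using BU psubset.prems by (intro det_on_path_less) (auto simp: PiE_def Pi_def)
          then show "of_bool (disjoint_family_on_walks s B \<pi>) * ?W B \<pi> = det_on B (?M \<pi>) * ?W B \<pi>"
            by simp
        qed
        finally have "det_on B ?A * perm_on (U - B) ?A =
            (\<Sum>\<pi>\<in>Pi\<^sub>E U straight_paths.
              (det_on B (?M (restrict \<pi> B)) * ?W B (restrict \<pi> B)) *
              (?W (U - B) (restrict \<pi> (U - B)) * perm_on (U - B) (?M (restrict \<pi> (U - B)))))"
          unfolding IH
          by (simp only: sum_PiE_split[OF BU, where f = "\<lambda>\<pi>. det_on B (?M \<pi>) * ?W B \<pi>"
                and g = "\<lambda>\<pi>. ?W (U - B) \<pi> * perm_on (U - B) (?M \<pi>)"])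
        also have "\<dots> = (\<Sum>\<pi>\<in>Pi\<^sub>E U straight_paths. ?W U \<pi> * (det_on B (?M \<pi>) * perm_on (U - B) (?M \<pi>)))"
        proof (rule sum.cong[OF refl])
          fix \<pi>
          \<comment> \<open>Entries with both indices in \<open>B\<close> depend only on the paths
            with index in \<open>B\<close>, so restricting the family changes nothing.\<close>
          have "det_on B (?M (restrict \<pi> B)) = det_on B (?M \<pi>)"
            by (rule det_on_cong) (simp add: path_less_def)
          moreover have "perm_on (U - B) (?M (restrict \<pi> (U - B))) = perm_on (U - B) (?M \<pi>)"
            by (rule perm_on_cong) (simp add: path_less_def)
          moreover have "?W B (restrict \<pi> B) = ?W B \<pi>" "?W (U - B) (restrict \<pi> (U - B)) = ?W (U - B) \<pi>"
            by simp_all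
          moreover have "?W U \<pi> = ?W (U - B) \<pi> * ?W B \<pi>"
            using BU psubset.hyps by (rule prod.subset_diff)
          ultimately show "(det_on B (?M (restrict \<pi> B)) * ?W B (restrict \<pi> B)) *
              (?W (U - B) (restrict \<pi> (U - B)) * perm_on (U - B) (?M (restrict \<pi> (U - B)))) =
              ?W U \<pi> * (det_on B (?M \<pi>) * perm_on (U - B) (?M \<pi>))"
            by (simp only: mult_ac)
        qed
        finally show ?thesis by (simp only: mult.assoc sum_distrib_left mult.left_commute)
      qed
      have "perm_on U ?A = - (\<Sum>B\<in>?S. (- 1) ^ card B * det_on B ?A * perm_on (U - B) ?A)"
        by (rule perm_on_recursion[OF psubset.hyps False])
      also have "\<dots> = - (\<Sum>B\<in>?S. \<Sum>\<pi>\<in>Pi\<^sub>E U straight_paths. ?W U \<pi> *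
            ((- 1) ^ card B * det_on B (?M \<pi>) * perm_on (U - B) (?M \<pi>)))"
        using B by (simp only: cong: sum.cong)
      also have "\<dots> = (\<Sum>\<pi>\<in>Pi\<^sub>E U straight_paths. ?W U \<pi> *
            - (\<Sum>B\<in>?S. (- 1) ^ card B * det_on B (?M \<pi>) * perm_on (U - B) (?M \<pi>)))"
        by (subst sum.swap) (simp only: sum_distrib_left sum_negf mult_minus_right)
      \<comment> \<open>Muir's recursion read backwards, once for each family.\<close>
      also have "\<dots> = (\<Sum>\<pi>\<in>Pi\<^sub>E U straight_paths. ?W U \<pi> * perm_on U (?M \<pi>))"
        by (simp only: perm_on_recursion[OF psubset.hyps False, symmetric])
      finally show ?thesis .
    qed
  qed
qed

text \<open>Each product of 0/1 entries is the indicator that \<open>v\<close> has no excedance. As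
  \<open>family_less\<close> relates paths and \<open>path_less\<close> indices, the indices must be
  recoverable from the paths.\<close>

lemma perm_on_path_less:
  assumes \<pi>: "\<pi> \<in> Pi\<^sub>E {1..n} straight_paths"
  shows "perm_on {1..n} (\<lambda>i j. of_bool (\<not> path_less \<pi> i j)) =
    real (card {v. v permutes {1..n} \<and> excedance_free D n s \<pi> v})"
proof -
  have walk: "awalk (s i) (\<pi> i) (t i)" if "i \<in> {1..n}" for i
    using \<pi> that by (auto simp: apath_iff_awalk PiE_def Pi_def)
  have inj: "inj_on \<pi> {1..n}"
  proof (rule inj_onI)
    fix i j assume ij: "i \<in> {1..n}" "j \<in> {1..n}" "\<pi> i = \<pi> j"
    \<comment> \<open>A nonempty arc list determines its first vertex, so equal paths have equal
      sources.\<close>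
    have "\<pi> i \<noteq> []" using awalk_source_sink_nonempty walk ij by blast
    then have "s i = s j" using awalk_ends[OF walk[OF ij(1)]] walk[OF ij(2)] ij(3) by metis
    then show "i = j" using sources_inj ij by (auto dest: inj_onD)
  qed
  have free: "(\<forall>i\<in>{1..n}. \<not> path_less \<pi> i (v i)) \<longleftrightarrow> excedance_free D n s \<pi> v"
    if v: "v permutes {1..n}" for v
  proof -
    have "(\<pi> i, \<pi> (v i)) \<in> family_less D n s \<pi> \<longleftrightarrow> path_less \<pi> i (v i)" if i: "i \<in> {1..n}" for i
    proof
      have vi: "v i \<in> {1..n}" using i permutes_in_image[OF v] by blast
      show "(\<pi> i, \<pi> (v i)) \<in> family_less D n s \<pi>" if "path_less \<pi> i (v i)"
        using that i vi unfolding family_less_def path_less_def by blast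
      assume "(\<pi> i, \<pi> (v i)) \<in> family_less D n s \<pi>"
      then obtain a b where ab: "\<pi> i = \<pi> a" "\<pi> (v i) = \<pi> b" "a \<in> {1..n}" "b \<in> {1..n}" "path_less \<pi> a b"
        unfolding family_less_def path_less_def by blast
      then have "i = a" "v i = b" using inj i vi by (auto dest: inj_onD)
      then show "path_less \<pi> i (v i)" using ab by simp
    qed
    then show ?thesis unfolding excedance_free_def by blast
  qed
  have "perm_on {1..n} (\<lambda>i j. of_bool (\<not> path_less \<pi> i j)) =
      (\<Sum>v | v permutes {1..n}. real (of_bool (\<forall>i\<in>{1..n}. \<not> path_less \<pi> i (v i))))"
    unfolding perm_on_def
  proof (rule sum.cong[OF refl])
    fix v
    show "(\<Prod>i\<in>{1..n}. of_bool (\<not> path_less \<pi> i (v i))) =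
        real (of_bool (\<forall>i\<in>{1..n}. \<not> path_less \<pi> i (v i)))"
    proof (cases "\<forall>i\<in>{1..n}. \<not> path_less \<pi> i (v i)")
      case False
      then have "\<exists>i\<in>{1..n}. (of_bool (\<not> path_less \<pi> i (v i)) :: real) = 0" by auto
      then have "(\<Prod>i\<in>{1..n}. (of_bool (\<not> path_less \<pi> i (v i)) :: real)) = 0"
        by (intro prod_zero) simp_all
      then show ?thesis using False by simp
    qed simp
  qed
  also have "\<dots> = (\<Sum>v | v permutes {1..n}. real (of_bool (excedance_free D n s \<pi> v)))"
    using free by (intro sum.cong) simp_all
  also have "\<dots> = real (card ({v. v permutes {1..n}} \<inter> {v. excedance_free D n s \<pi> v}))"
    by (simp add: finite_permutations)
  also have "{v. v permutes {1..n}} \<inter> {v. excedance_free D n s \<pi> v} =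
      {v. v permutes {1..n} \<and> excedance_free D n s \<pi> v}" by blast
  finally show ?thesis .
qed

end

theorem theorem4p14:
  fixes D :: "('a, 'b) pre_digraph"
    and n :: nat
    and s t :: "nat \<Rightarrow> 'a"
    and wt :: "'b \<Rightarrow> real"
  assumes "planar_network D n s t wt"
  shows "permanent n (path_matrix D s t wt) =
    (\<Sum>\<pi> \<in> path_families D n s t id.
       family_weight n wt \<pi> *
       real (card {v. v permutes {1..n} \<and> excedance_free D n s \<pi> v}))"
proof -
  interpret planar_network D n s t wt by (fact assms)
  have "permanent n (path_matrix D s t wt) = perm_on {1..n} (path_matrix D s t wt)"
    by (simp add: permanent_def perm_on_def)
  also have "\<dots> = (\<Sum>\<pi>\<in>Pi\<^sub>E {1..n} straight_paths. (\<Prod>i\<in>{1..n}. path_weight wt (\<pi> i)) *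
       perm_on {1..n} (\<lambda>i j. of_bool (\<not> path_less \<pi> i j)))"
    by (rule perm_on_path_matrix) simp
  also have "\<dots> = (\<Sum>\<pi>\<in>Pi\<^sub>E {1..n} straight_paths. family_weight n wt \<pi> *
       real (card {v. v permutes {1..n} \<and> excedance_free D n s \<pi> v}))"
    using perm_on_path_less by (intro sum.cong) (simp_all add: family_weight_def)
  finally show ?thesis by (simp add: path_families_def)
qed

end
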